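(* Let $\mathcal P\subset\mathcal M_1(\Omega_1,\mathcal A_1)$ and $\mathcal Q\subset\mathcal M_1(\Omega_2,\mathcal A_2)$ be nonempty families of probability measures. Let $k_1:\mathcal P\to\mathbb R$ be differentiable at $P_0\in\mathcal P$ with a gradient $\dot k_1\in L_2^{(0)}(P_0)$ and canonical gradient $\widetilde k_1\in T(P_0,\mathcal P)$, and let $k_2:\mathcal Q\to\mathbb R$ be differentiable at $Q_0\in\mathcal Q$ with a gradient $\dot k_2\in L_2^{(0)}(Q_0)$ and canonical gradient $\widetilde k_2\in T(Q_0,\mathcal Q)$. Let $U\subset\mathbb R^2$ be open with $\{k_1(P):P\in\mathcal P\}\times\{k_2(Q):Q\in\mathcal Q\}\subset U$ and let $f:U\to\mathbb R$ be differentiable at the point $(k_1(P_0),k_2(Q_0))$. Put $$c_1=\frac{\partial f}{\partial x}(x,y)\Big|_{(x,y)=(k_1(P_0),k_2(Q_0))},\qquad c_2=\frac{\partial f}{\partial y}(x,y)\Big|_{(x,y)=(k_1(P_0),k_2(Q_0))}.$$ Then the functional $k:\mathcal P\otimes\mathcal Q\to\mathbb R$, $P\otimes Q\mapsto f(k_1(P),k_2(Q))$, is differentiable at $P_0\otimes Q_0$; the map $\dot k:\Omega_1\times\Omega_2\to\mathbb R$, $(\omega_1,\omega_2)\mapsto c_1\dot k_1(\omega_1)+c_2\dot k_2(\omega_2)$ is a gradient of $k$ at $P_0\otimes Q_0$; and the map $\widetilde k:\Omega_1\times\Omega_2\to\mathbb R$, $(\omega_1,\omega_2)\mapsto c_1\widetilde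 k_1(\omega_1)+c_2\widetilde k_2(\omega_2)$ is the canonical gradient of $k$ at $P_0\otimes Q_0$.
   Context: $\mathcal M_1(\Omega,\mathcal A)$ is the set of probability measures on the measurable space $(\Omega,\mathcal A)$; $\mathcal P\otimes\mathcal Q=\{P\otimes Q:P\in\mathcal P,Q\in\mathcal Q\}$. For $P,Q\in\mathcal M_1(\Omega,\mathcal A)$, $\frac{dP}{dQ}$ denotes the density quotient: a measurable $L:\Omega\to[0,\infty]$ with $P(A)=\int_A L\,dQ+P(A\cap\{L=\infty\})$ for all $A\in\mathcal A$ and $Q(L<\infty)=1$. For a nonempty family $\mathcal R\subset\mathcal M_1(\Omega,\mathcal A)$, a map $(-\varepsilon,\varepsilon)\to\mathcal R$, $t\mapsto R_t$ ($\varepsilon>0$) is an $L_2(R_0)$-differentiable curve in $\mathcal R$ with tangent $g\in L_2(R_0)$ if, as $t\to0$, $\bigl\|2\bigl((dR_t/dR_0)^{1/2}-1\bigr)-tg\bigr\|_{L_2(R_0)}=o(|t|)$ and $R_t(\{dR_t/dR_0=\infty\})=o(t^2)$. Tangents lie in $L_2^{(0)}(R)=\{h\in L_2(R):\int h\,dR=0\}$, $R=R_0$. The tangent cone $K(R,\mathcal R)$ is the set of tangents of all $L_2(R_0)$-differentiable curves in $\mathcal R$ with $R_0=R$; the tangent space $T(R,\mathcal R)$ is the $L_2(R)$-closure of the linear span of $K(R,\mathcal R)$. A functional $k:\mathcal R\to\mathbb R$ is differentiable at $R\in\mathcal R$ with gradient $\dot k\in L_2^{(0)}(R)$ if for every $L_2(R_0)$-differentiable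 curve $t\mapsto R_t$ in $\mathcal R$ with tangent $g$ and $R_0=R$ one has $\lim_{t\downarrow0}\frac1t(k(R_t)-k(R_0))=\int\dot k g\,dR_0$. The canonical gradient is the unique gradient lying in $T(R,\mathcal R)$ (equivalently, the gradient of minimal $L_2(R)$-norm). *)

theory Defs
  imports "HOL-Probability.Probability" "HOL-Library.Landau_Symbols"
begin

definition is_density_quotient :: "'a measure \<Rightarrow> 'a measure \<Rightarrow> ('a \<Rightarrow> ennreal) \<Rightarrow> bool" where
  "is_density_quotient P Q L \<longleftrightarrow>
     L \<in> borel_measurable Q \<and>
     (\<forall>A\<in>sets Q. emeasure P A =
        (\<integral>\<^sup>+x\<in>A. L x \<partial>Q) + emeasure P (A \<inter> {x \<in> space Q. L x = \<infinity>})) \<and>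
     emeasure Q {x \<in> space Q. L x < \<infinity>} = 1"

text \<open>
  A density quotient is determined up to a set that is null for both measures, so it does not
  matter which one is selected.  One exists for any two probability measures on the same
  measurable space, see \<open>is_density_quotient_density_quotient\<close> below.
\<close>
definition density_quotient :: "'a measure \<Rightarrow> 'a measure \<Rightarrow> 'a \<Rightarrow> ennreal" where
  "density_quotient P Q = (SOME L. is_density_quotient P Q L)"

lemma density_quotient_exists:
  fixes P Q :: "'a measure"
  assumes "prob_space P" "prob_space Q" and sets_eq: "sets P = sets Q"
  shows "\<exists>L. is_density_quotient P Q L"
proof -
  interpret P: prob_space P by fact
  interpret Q: prob_space Q by fact
  have sp: "space P = space Q" using sets_eq by (rule sets_eq_imp_space_eq)
  define \<mu> where "\<mu> = measure_of (space Q) (sets Q) (\<lambda>A. emeasure P A + emeasure Q A)"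
  have s\<mu>: "sets \<mu> = sets Q" and sp\<mu>: "space \<mu> = space Q"
    by (simp_all add: \<mu>_def)
  have e\<mu>: "emeasure \<mu> A = emeasure P A + emeasure Q A" if A: "A \<in> sets Q" for A
    unfolding \<mu>_def
  proof (rule emeasure_measure_of_sigma)
    show "sigma_algebra (space Q) (sets Q)" by (rule sets.sigma_algebra_axioms)
    show "positive (sets Q) (\<lambda>A. emeasure P A + emeasure Q A)" by (simp add: positive_def)
    show "countably_additive (sets Q) (\<lambda>A. emeasure P A + emeasure Q A)"
      unfolding countably_additive_def
      by (auto simp: suminf_add[symmetric] suminf_emeasure sets_eq)
  qed (rule A)
  interpret \<mu>: finite_measure \<mu>
    by standard (auto simp: sp\<mu> e\<mu> P.emeasure_finite Q.emeasure_finite)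
  have acP: "absolutely_continuous \<mu> P" and acQ: "absolutely_continuous \<mu> Q"
    by (auto simp: absolutely_continuous_def null_sets_def s\<mu> sets_eq e\<mu>)
  define p where "p = RN_deriv \<mu> P"
  define q where "q = RN_deriv \<mu> Q"
  have dP: "density \<mu> p = P" unfolding p_def
    by (rule \<mu>.density_RN_deriv[OF acP]) (simp add: s\<mu> sets_eq)
  have dQ: "density \<mu> q = Q" unfolding q_def
    by (rule \<mu>.density_RN_deriv[OF acQ]) (simp add: s\<mu>)
  have [measurable]: "p \<in> borel_measurable \<mu>" "q \<in> borel_measurable \<mu>"
    by (auto simp: p_def q_def)
  have fin: "AE x in \<mu>. p x \<noteq> \<infinity> \<and> q x \<noteq> \<infinity>"
  proof -
    have "AE x in \<mu>. p x \<noteq> \<infinity>"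
      unfolding p_def by (rule \<mu>.RN_deriv_finite[OF _ acP])
        (auto simp: s\<mu> sets_eq P.sigma_finite_measure_axioms)
    moreover have "AE x in \<mu>. q x \<noteq> \<infinity>"
      unfolding q_def by (rule \<mu>.RN_deriv_finite[OF _ acQ])
        (auto simp: s\<mu> Q.sigma_finite_measure_axioms)
    ultimately show ?thesis by eventually_elim simp
  qed
  define L where "L = (\<lambda>x. if q x = 0 then (if p x = 0 then 0 else \<infinity>) else p x / q x)"
  have L[measurable]: "L \<in> borel_measurable \<mu>" unfolding L_def by measurable
  have key: "AE x in \<mu>. p x = q x * L x + p x * indicator {x \<in> space Q. L x = \<infinity>} x \<and>
      (q x \<noteq> 0 \<longrightarrow> L x < \<infinity>)"
    using fin AE_space
  proof eventually_elim
    case (elim x)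
    have "q x * (p x / q x) = p x \<and> p x / q x < \<infinity>" if "q x \<noteq> 0"
      using that elim
      by (metis ennreal_divide_eq_top_iff ennreal_mult_divide_eq ennreal_times_divide
          infinity_ennreal_def mult.commute top.not_eq_extremum)
    then show ?case using elim by (auto simp: L_def sp\<mu> indicator_def)
  qed
  have "is_density_quotient P Q L"
    unfolding is_density_quotient_def
  proof (intro conjI ballI)
    show "L \<in> borel_measurable Q" using L s\<mu> measurable_cong_sets by blast
    fix A assume "A \<in> sets Q"
    then have A[measurable]: "A \<in> sets \<mu>" by (simp add: s\<mu>)
    have Inf[measurable]: "{x \<in> space Q. L x = \<infinity>} \<in> sets \<mu>"
      unfolding sp\<mu>[symmetric] by measurable
    have [measurable]: "A \<inter> {x \<in> space Q. L x = \<infinity>} \<in> sets \<mu>"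
      using A Inf by (rule sets.Int)
    have "emeasure P A = (\<integral>\<^sup>+x. p x * indicator A x \<partial>\<mu>)"
      by (subst dP[symmetric]) (simp add: emeasure_density)
    also have "\<dots> = (\<integral>\<^sup>+x. q x * (L x * indicator A x) +
        p x * indicator (A \<inter> {x \<in> space Q. L x = \<infinity>}) x \<partial>\<mu>)"
      by (rule nn_integral_cong_AE, use key in eventually_elim)
        (auto split: split_indicator simp: ac_simps)
    also have "\<dots> = (\<integral>\<^sup>+x. q x * (L x * indicator A x) \<partial>\<mu>) +
        (\<integral>\<^sup>+x. p x * indicator (A \<inter> {x \<in> space Q. L x = \<infinity>}) x \<partial>\<mu>)"
      by (rule nn_integral_add) measurable
    also have "(\<integral>\<^sup>+x. q x * (L x * indicator A x) \<partial>\<mu>) = (\<integral>\<^sup>+x\<in>A. L x \<partial>Q)"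
      by (subst dQ[symmetric], subst nn_integral_density) auto
    also have "(\<integral>\<^sup>+x. p x * indicator (A \<inter> {x \<in> space Q. L x = \<infinity>}) x \<partial>\<mu>) =
        emeasure P (A \<inter> {x \<in> space Q. L x = \<infinity>})"
      by (rule emeasure_density[of p \<mu>, unfolded dP, symmetric]) measurable
    finally show "emeasure P A =
        (\<integral>\<^sup>+x\<in>A. L x \<partial>Q) + emeasure P (A \<inter> {x \<in> space Q. L x = \<infinity>})" .
  next
    have "AE x in density \<mu> q. L x < \<infinity>"
      by (subst AE_density) (use key in \<open>auto simp: zero_less_iff_neq_zero\<close>)
    then have "AE x in Q. L x < \<infinity>" by (subst (asm) dQ)
    moreover have "{x \<in> space Q. L x < \<infinity>} \<in> sets Q"
      unfolding sp\<mu>[symmetric] s\<mu>[symmetric] by measurable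
    ultimately show "emeasure Q {x \<in> space Q. L x < \<infinity>} = 1"
      by (intro Q.emeasure_eq_1_AE) auto
  qed
  then show ?thesis by (rule exI[of _ L])
qed

lemma is_density_quotient_density_quotient:
  assumes "prob_space P" "prob_space Q" "sets P = sets Q"
  shows "is_density_quotient P Q (density_quotient P Q)"
  unfolding density_quotient_def by (rule someI_ex[OF density_quotient_exists[OF assms]])

text \<open>Elements of \<open>L\<^sub>2\<close> are represented by functions rather than by equivalence classes.\<close>

definition L2_space :: "'a measure \<Rightarrow> ('a \<Rightarrow> real) set" where
  "L2_space R = {h \<in> borel_measurable R. integrable R (\<lambda>x. (h x)\<^sup>2)}"

definition L2_zero_space :: "'a measure \<Rightarrow> ('a \<Rightarrow> real) set" where
  "L2_zero_space R = {h \<in> L2_space R. (\<integral>x. h x \<partial>R) = 0}"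

text \<open>Only applied to members of \<open>L2_space R\<close>.\<close>
definition L2_norm :: "'a measure \<Rightarrow> ('a \<Rightarrow> real) \<Rightarrow> real" where
  "L2_norm R h = sqrt (\<integral>x. (h x)\<^sup>2 \<partial>R)"

definition linear_span :: "('a \<Rightarrow> real) set \<Rightarrow> ('a \<Rightarrow> real) set" where
  "linear_span S = {\<lambda>x. \<Sum>g\<in>F. c g * g x | c F. finite F \<and> F \<subseteq> S}"

definition L2_closure :: "'a measure \<Rightarrow> ('a \<Rightarrow> real) set \<Rightarrow> ('a \<Rightarrow> real) set" where
  "L2_closure R S = {h \<in> L2_space R. \<forall>e>0. \<exists>s\<in>S. L2_norm R (\<lambda>x. h x - s x) < e}"

text \<open>
  That tangents have mean zero is a consequence and not part of the definition.
  A curve is defined on the interval from \<open>-\<epsilon>\<close> to \<open>\<epsilon>\<close>; values of \<open>R\<close> outside it are irrelevant.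
  The density quotient is finite \<open>R 0\<close>-almost everywhere, so applying \<open>enn2real\<close> (which sends
  \<open>\<infinity>\<close> to \<open>0\<close>) does not affect the norm; moreover it is \<open>R 0\<close>-integrable, so its square root is in
  \<open>L2_space (R 0)\<close>.
\<close>
definition L2_differentiable_curve ::
    "'a measure set \<Rightarrow> real \<Rightarrow> (real \<Rightarrow> 'a measure) \<Rightarrow> ('a \<Rightarrow> real) \<Rightarrow> bool" where
  "L2_differentiable_curve \<R> \<epsilon> R g \<longleftrightarrow>
     \<epsilon> > 0 \<and> (\<forall>t\<in>{-\<epsilon><..<\<epsilon>}. R t \<in> \<R>) \<and> g \<in> L2_space (R 0) \<and>
     (\<lambda>t. L2_norm (R 0)
        (\<lambda>x. 2 * (sqrt (enn2real (density_quotient (R t) (R 0) x)) - 1) - t * g x))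
       \<in> o[at 0](\<lambda>t. \<bar>t\<bar>) \<and>
     (\<lambda>t. measure (R t) {x \<in> space (R t). density_quotient (R t) (R 0) x = \<infinity>})
       \<in> o[at 0](\<lambda>t. t\<^sup>2)"

definition tangent_cone :: "'a measure \<Rightarrow> 'a measure set \<Rightarrow> ('a \<Rightarrow> real) set" where
  "tangent_cone R0 \<R> = {g. \<exists>\<epsilon> R. L2_differentiable_curve \<R> \<epsilon> R g \<and> R 0 = R0}"

definition tangent_space :: "'a measure \<Rightarrow> 'a measure set \<Rightarrow> ('a \<Rightarrow> real) set" where
  "tangent_space R0 \<R> = L2_closure R0 (linear_span (tangent_cone R0 \<R>))"

definition is_gradient ::
    "('a measure \<Rightarrow> real) \<Rightarrow> 'a measure set \<Rightarrow> 'a measure \<Rightarrow> ('a \<Rightarrow> real) \<Rightarrow> bool" where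
  "is_gradient k \<R> R0 \<kappa> \<longleftrightarrow> \<kappa> \<in> L2_zero_space R0 \<and>
     (\<forall>\<epsilon> R g. L2_differentiable_curve \<R> \<epsilon> R g \<and> R 0 = R0 \<longrightarrow>
        ((\<lambda>t. (k (R t) - k (R 0)) / t) \<longlongrightarrow> (\<integral>x. \<kappa> x * g x \<partial>R0)) (at_right 0))"

definition differentiable_functional_at ::
    "('a measure \<Rightarrow> real) \<Rightarrow> 'a measure set \<Rightarrow> 'a measure \<Rightarrow> bool" where
  "differentiable_functional_at k \<R> R0 \<longleftrightarrow> (\<exists>\<kappa>. is_gradient k \<R> R0 \<kappa>)"

definition is_canonical_gradient ::
    "('a measure \<Rightarrow> real) \<Rightarrow> 'a measure set \<Rightarrow> 'a measure \<Rightarrow> ('a \<Rightarrow> real) \<Rightarrow> bool" where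
  "is_canonical_gradient k \<R> R0 \<kappa> \<longleftrightarrow>
     is_gradient k \<R> R0 \<kappa> \<and> \<kappa> \<in> tangent_space R0 \<R> \<and>
     (\<forall>\<kappa>'. is_gradient k \<R> R0 \<kappa>' \<and> \<kappa>' \<in> tangent_space R0 \<R> \<longrightarrow>
        (AE x in R0. \<kappa>' x = \<kappa> x))"

definition product_family :: "'a measure set \<Rightarrow> 'b measure set \<Rightarrow> ('a \<times> 'b) measure set" where
  "product_family \<P> \<Q> = {P \<Otimes>\<^sub>M Q | P Q. P \<in> \<P> \<and> Q \<in> \<Q>}"

text \<open>A functional on a product family may thus be prescribed in terms of the two factors.\<close>
lemma pair_prob_measure_inject:
  assumes P: "P \<in> space (prob_algebra M)" "P' \<in> space (prob_algebra M)"
    and Q: "Q \<in> space (prob_algebra N)" "Q' \<in> space (prob_algebra N)"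
    and eq: "P \<Otimes>\<^sub>M Q = P' \<Otimes>\<^sub>M Q'"
  shows "P = P' \<and> Q = Q'"
proof -
  have s: "sets P = sets M" "sets P' = sets M" "sets Q = sets N" "sets Q' = sets N"
    and pr: "prob_space P" "prob_space P'" "prob_space Q" "prob_space Q'"
    using P Q by (auto simp: space_prob_algebra)
  interpret P: prob_space P by fact
  interpret P': prob_space P' by fact
  interpret Q: prob_space Q by fact
  interpret Q': prob_space Q' by fact
  have sp: "space P = space M" "space P' = space M" "space Q = space N" "space Q' = space N"
    using s by (auto dest: sets_eq_imp_space_eq)
  have 1: "emeasure (P \<Otimes>\<^sub>M Q) (A \<times> B) = emeasure (P' \<Otimes>\<^sub>M Q') (A \<times> B)" for A B
    by (simp add: eq)
  have "P = P'"
  proof (rule measure_eqI)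
    fix A assume "A \<in> sets P"
    then show "emeasure P A = emeasure P' A"
      using 1[of A "space N"] s sp Q.emeasure_space_1 Q'.emeasure_space_1
      by (simp add: Q.emeasure_pair_measure_Times Q'.emeasure_pair_measure_Times)
  qed (simp add: s)
  moreover have "Q = Q'"
  proof (rule measure_eqI)
    fix B assume "B \<in> sets Q"
    then show "emeasure Q B = emeasure Q' B"
      using 1[of "space M" B] s sp P.emeasure_space_1 P'.emeasure_space_1
      by (simp add: Q.emeasure_pair_measure_Times Q'.emeasure_pair_measure_Times)
  qed (simp add: s)
  ultimately show ?thesis by simp
qed

end

theory Submission
  imports Defs
begin

text \<open>
  Let \<open>R t = P t \<Otimes> Q t\<close> be a differentiable curve with tangent \<open>g\<close>, and let \<open>s t\<close>, \<open>u t\<close> be the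
  square roots of the density quotients of the two factors.  The square root of the density
  quotient of \<open>R t\<close> is \<open>s t \<omega>1 * u t \<omega>2\<close>.  Integrating out \<open>\<omega>2\<close> is an \<open>L2\<close>-contraction, so
  \<open>2 (a t * s t - 1) - t g1\<close> is small, where \<open>a t = \<integral> u t dQ0\<close> and \<open>g1 = \<integral> g(-, \<omega>2) dQ0\<close>.  Since
  \<open>\<integral> s t dP0 \<le> 1\<close>, the quantity \<open>2 (1 - a t)\<close> is at most the squared norm of \<open>s t * u t - 1\<close> plus
  the singular mass of \<open>R t\<close>, which is \<open>O(t^2)\<close>; hence the factor \<open>a t\<close> may be dropped and \<open>P t\<close> is
  a differentiable curve with tangent \<open>g1\<close>.  The gradient of \<open>k\<close> then follows from the chain rule
  and Fubini.  The candidate canonical gradient lies in the tangent space because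
  \<open>P t \<Otimes> Q0\<close> and \<open>P0 \<Otimes> Q t\<close> are curves in the product family, and gradients in the tangent space
  are unique because their difference is orthogonal to all tangents.
\<close>

subsection \<open>The space of square integrable functions\<close>

lemma L2_spaceD:
  assumes "h \<in> L2_space R"
  shows "h \<in> borel_measurable R" "integrable R (\<lambda>x. (h x)\<^sup>2)"
  using assms by (auto simp: L2_space_def)

lemma L2_norm_nonneg: "0 \<le> L2_norm R h"
  by (simp add: L2_norm_def)

lemma L2_norm_sq: "(L2_norm R h)\<^sup>2 = (\<integral>x. (h x)\<^sup>2 \<partial>R)"
  by (simp add: L2_norm_def)

text \<open>The bound 2 |f g| <= f^2 + g^2 dominates the product by an integrable function.\<close>

lemma integrable_mult_L2:
  assumes "f \<in> L2_space R" "g \<in> L2_space R"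
  shows "integrable R (\<lambda>x. f x * g x)"
proof (rule Bochner_Integration.integrable_bound)
  show "integrable R (\<lambda>x. (f x)\<^sup>2 + (g x)\<^sup>2)"
    using assms by (auto simp: L2_space_def)
  show "(\<lambda>x. f x * g x) \<in> borel_measurable R"
    using assms by (auto simp: L2_space_def)
  show "AE x in R. norm (f x * g x) \<le> norm ((f x)\<^sup>2 + (g x)\<^sup>2)"
  proof (rule AE_I2)
    fix x
    have "2 * (\<bar>f x\<bar> * \<bar>g x\<bar>) \<le> (f x)\<^sup>2 + (g x)\<^sup>2"
      using sum_squares_bound[of "\<bar>f x\<bar>" "\<bar>g x\<bar>"] by simp
    moreover have "0 \<le> \<bar>f x\<bar> * \<bar>g x\<bar>" by simp
    ultimately have "\<bar>f x\<bar> * \<bar>g x\<bar> \<le> (f x)\<^sup>2 + (g x)\<^sup>2" by linarith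
    then show "norm (f x * g x) \<le> norm ((f x)\<^sup>2 + (g x)\<^sup>2)"
      by (simp add: abs_mult)
  qed
qed

lemma L2_space_scale: "f \<in> L2_space R \<Longrightarrow> (\<lambda>x. c * f x) \<in> L2_space R"
  by (auto simp: L2_space_def power_mult_distrib)

lemma L2_space_add:
  assumes "f \<in> L2_space R" "g \<in> L2_space R"
  shows "(\<lambda>x. f x + g x) \<in> L2_space R"
proof -
  have "integrable R (\<lambda>x. (f x)\<^sup>2 + (g x)\<^sup>2 + 2 * (f x * g x))"
    using assms integrable_mult_L2[OF assms] by (auto simp: L2_space_def)
  then show ?thesis using assms by (auto simp: L2_space_def power2_sum mult.assoc)
qed

lemma L2_space_diff:
  assumes "f \<in> L2_space R" "g \<in> L2_space R"
  shows "(\<lambda>x. f x - g x) \<in> L2_space R"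
  using L2_space_add[OF assms(1) L2_space_scale[OF assms(2), of "-1"]] by simp

lemma L2_space_const: "prob_space R \<Longrightarrow> (\<lambda>x. c) \<in> L2_space R"
  using finite_measure.integrable_const[OF prob_space.finite_measure, of R "c\<^sup>2"]
  by (simp add: L2_space_def)

lemma L2_norm_cong_AE:
  assumes "AE x in R. f x = g x" "f \<in> borel_measurable R" "g \<in> borel_measurable R"
  shows "L2_norm R f = L2_norm R g"
proof -
  have "(\<integral>x. (f x)\<^sup>2 \<partial>R) = (\<integral>x. (g x)\<^sup>2 \<partial>R)"
    by (rule integral_cong_AE) (use assms in \<open>auto elim: eventually_mono\<close>)
  then show ?thesis by (simp add: L2_norm_def)
qed

lemma L2_norm_scale: "L2_norm R (\<lambda>x. c * f x) = \<bar>c\<bar> * L2_norm R f"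
  by (simp add: L2_norm_def power_mult_distrib real_sqrt_mult)

section \<open>Cauchy-Schwarz, the triangle inequality and means\<close>

text \<open>The integral of \<open>(a * f x + b * g x)\<close> squared is a nonnegative quadratic
  form in \<open>a\<close> and \<open>b\<close>, and evaluating it at suitable points gives the
  inequality. A function of norm 0 need not vanish identically, so that case is treated
  separately.\<close>

lemma L2_Cauchy_Schwarz:
  assumes f: "f \<in> L2_space R" and g: "g \<in> L2_space R"
  shows "\<bar>\<integral>x. f x * g x \<partial>R\<bar> \<le> L2_norm R f * L2_norm R g"
proof -
  let ?A = "\<integral>x. (f x)\<^sup>2 \<partial>R" and ?B = "\<integral>x. (g x)\<^sup>2 \<partial>R" and ?C = "\<integral>x. f x * g x \<partial>R"
  have nn: "0 \<le> ?A" "0 \<le> ?B" by auto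
  have quad: "0 \<le> a\<^sup>2 * ?A + 2 * (a * b * ?C) + b\<^sup>2 * ?B" for a b
  proof -
    have "0 \<le> (\<integral>x. (a * f x + b * g x)\<^sup>2 \<partial>R)" by simp
    also have "(\<lambda>x. (a * f x + b * g x)\<^sup>2) =
        (\<lambda>x. a\<^sup>2 * (f x)\<^sup>2 + 2 * (a * b * (f x * g x)) + b\<^sup>2 * (g x)\<^sup>2)"
      by (auto simp: power2_eq_square algebra_simps)
    also have "(\<integral>x. \<dots> x \<partial>R) = a\<^sup>2 * ?A + 2 * (a * b * ?C) + b\<^sup>2 * ?B"
      using L2_spaceD[OF f] L2_spaceD[OF g] integrable_mult_L2[OF f g] by simp
    finally show ?thesis .
  qed
  have "?C\<^sup>2 \<le> ?A * ?B"
  proof (cases "?B = 0")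
    case True
    show ?thesis
    proof (rule ccontr)
      assume "\<not> ?thesis"
      then have C: "?C \<noteq> 0" using True by auto
      \<comment> \<open>With \<open>?B = 0\<close> the form is affine in its second argument; this
        \<open>a\<close> makes it take the value -1 at \<open>(1, a)\<close>.\<close>
      define a where "a = - ((?A + 1) / (2 * ?C))"
      have "a * ?C = - ((?A + 1) / 2)" using C by (simp add: a_def)
      then show False using quad[of 1 a] True nn(1) by simp
    qed
  next
    case False
    then have B: "0 < ?B" using nn by linarith
    \<comment> \<open>For fixed first argument \<open>?B\<close> the form is smallest at second
      argument \<open>- ?C\<close>, where it factors as \<open>?B\<close> times the wanted
      difference.\<close>
    have "0 \<le> ?B\<^sup>2 * ?A + 2 * (?B * - ?C * ?C) + (- ?C)\<^sup>2 * ?B" by (rule quad)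
    also have "\<dots> = ?B * (?A * ?B - ?C\<^sup>2)" by (simp add: power2_eq_square algebra_simps)
    finally show ?thesis using B by (simp add: zero_le_mult_iff)
  qed
  then have "sqrt (?C\<^sup>2) \<le> sqrt (?A * ?B)" by (rule real_sqrt_le_mono)
  then show ?thesis by (simp add: L2_norm_def real_sqrt_mult)
qed

lemma L2_norm_triangle:
  assumes f: "f \<in> L2_space R" and g: "g \<in> L2_space R"
  shows "L2_norm R (\<lambda>x. f x + g x) \<le> L2_norm R f + L2_norm R g"
proof (rule power2_le_imp_le)
  have "(L2_norm R (\<lambda>x. f x + g x))\<^sup>2 = (\<integral>x. (f x)\<^sup>2 + (g x)\<^sup>2 + 2 * (f x * g x) \<partial>R)"
    by (simp add: L2_norm_sq power2_sum mult.assoc)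
  also have "\<dots> = (L2_norm R f)\<^sup>2 + (L2_norm R g)\<^sup>2 + 2 * (\<integral>x. f x * g x \<partial>R)"
    using L2_spaceD[OF f] L2_spaceD[OF g] integrable_mult_L2[OF f g] by (simp add: L2_norm_sq)
  also have "\<dots> \<le> (L2_norm R f + L2_norm R g)\<^sup>2"
    unfolding power2_sum using L2_Cauchy_Schwarz[OF f g] by linarith
  finally show "(L2_norm R (\<lambda>x. f x + g x))\<^sup>2 \<le> (L2_norm R f + L2_norm R g)\<^sup>2" .
qed (simp add: L2_norm_nonneg)

lemma L2_space_integrable: "prob_space R \<Longrightarrow> f \<in> L2_space R \<Longrightarrow> integrable R f"
  by (rule finite_measure.square_integrable_imp_integrable[OF prob_space.finite_measure])
    (auto dest: L2_spaceD)

text \<open>This is nonnegativity of the variance. It serves twice: it makes integrating out a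
  coordinate a contraction, and it bounds the mean of a root density by its norm.\<close>

lemma square_expectation_le:
  assumes "prob_space R" "f \<in> L2_space R"
  shows "(\<integral>x. f x \<partial>R)\<^sup>2 \<le> (\<integral>x. (f x)\<^sup>2 \<partial>R)"
proof -
  interpret prob_space R by fact
  show ?thesis
    using variance_positive[of f]
      variance_eq[OF L2_space_integrable[OF assms] L2_spaceD(2)[OF assms(2)]]
    by (simp only:)
qed


subsection \<open>Square integrable functions on product spaces\<close>

lemma pair_prob:
  assumes "prob_space P" "prob_space Q"
  shows "pair_sigma_finite P Q" "pair_prob_space P Q" "prob_space (P \<Otimes>\<^sub>M Q)"
proof -
  interpret P: prob_space P by fact
  interpret Q: prob_space Q by fact
  interpret PQ: pair_prob_space P Q ..
  show "pair_sigma_finite P Q" "pair_prob_space P Q" "prob_space (P \<Otimes>\<^sub>M Q)" by unfold_locales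
qed

section \<open>Integrating out a coordinate, projections and exchange of coordinates\<close>

text \<open>On almost every section the square of the mean is at most the mean of the square;
  integrating this over \<open>P\<close> and applying Fubini gives both claims.\<close>

lemma
  fixes \<phi> :: "'a \<times> 'b \<Rightarrow> real"
  assumes P: "prob_space P" and Q: "prob_space Q" and \<phi>: "\<phi> \<in> L2_space (P \<Otimes>\<^sub>M Q)"
  shows partial_integral_L2: "(\<lambda>x. \<integral>y. \<phi> (x, y) \<partial>Q) \<in> L2_space P"
    and L2_norm_partial_integral: "L2_norm P (\<lambda>x. \<integral>y. \<phi> (x, y) \<partial>Q) \<le> L2_norm (P \<Otimes>\<^sub>M Q) \<phi>"
proof -
  interpret pair_prob_space P Q using pair_prob[OF P Q] by simp
  have [measurable]: "\<phi> \<in> borel_measurable (P \<Otimes>\<^sub>M Q)" and i: "integrable (P \<Otimes>\<^sub>M Q) (\<lambda>z. (\<phi> z)\<^sup>2)"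
    using L2_spaceD[OF \<phi>] by auto
  have m: "(\<lambda>x. \<integral>y. \<phi> (x, y) \<partial>Q) \<in> borel_measurable P" by measurable
  have ae: "AE x in P. (\<integral>y. \<phi> (x, y) \<partial>Q)\<^sup>2 \<le> (\<integral>y. (\<phi> (x, y))\<^sup>2 \<partial>Q)"
    using AE_integrable_fst'[OF i] AE_space
  proof eventually_elim
    case (elim x)
    then have "(\<lambda>y. \<phi> (x, y)) \<in> L2_space Q" by (auto simp: L2_space_def)
    then show ?case by (rule square_expectation_le[OF Q])
  qed
  have i2: "integrable P (\<lambda>x. \<integral>y. (\<phi> (x, y))\<^sup>2 \<partial>Q)" by (rule integrable_fst'[OF i])
  have i3: "integrable P (\<lambda>x. (\<integral>y. \<phi> (x, y) \<partial>Q)\<^sup>2)"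
    by (rule Bochner_Integration.integrable_bound[OF i2])
      (use m ae in \<open>auto elim!: eventually_mono\<close>)
  show "(\<lambda>x. \<integral>y. \<phi> (x, y) \<partial>Q) \<in> L2_space P"
    using m i3 by (simp add: L2_space_def)
  show "L2_norm P (\<lambda>x. \<integral>y. \<phi> (x, y) \<partial>Q) \<le> L2_norm (P \<Otimes>\<^sub>M Q) \<phi>"
    unfolding L2_norm_def integral_fst'[OF i, symmetric]
    by (rule real_sqrt_le_mono, rule integral_mono_AE[OF i3 i2 ae])
qed

lemma
  fixes f :: "'a \<Rightarrow> real"
  assumes P: "prob_space P" and Q: "prob_space Q"
  shows integrable_pair_fst: "integrable P f \<Longrightarrow> integrable (P \<Otimes>\<^sub>M Q) (\<lambda>z. f (fst z))"
    and integral_pair_fst: "f \<in> borel_measurable P \<Longrightarrow> (\<integral>z. f (fst z) \<partial>(P \<Otimes>\<^sub>M Q)) = (\<integral>x. f x \<partial>P)"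
proof -
  interpret Q: prob_space Q by fact
  show "integrable P f \<Longrightarrow> integrable (P \<Otimes>\<^sub>M Q) (\<lambda>z. f (fst z))"
    by (rule integrable_distr[OF measurable_fst]) (simp add: Q.distr_pair_fst)
  show "f \<in> borel_measurable P \<Longrightarrow> (\<integral>z. f (fst z) \<partial>(P \<Otimes>\<^sub>M Q)) = (\<integral>x. f x \<partial>P)"
    by (subst (2) Q.distr_pair_fst[of P, symmetric]) (simp add: integral_distr)
qed

text \<open>Exchanging the coordinates reduces facts about the second factor to those about the
  first.\<close>

lemma
  fixes f :: "'a \<times> 'b \<Rightarrow> real"
  assumes P: "prob_space P" and Q: "prob_space Q"
  shows integrable_pair_swap: "integrable (P \<Otimes>\<^sub>M Q) f \<Longrightarrow> integrable (Q \<Otimes>\<^sub>M P) (\<lambda>z. f (prod.swap z))"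
    and integral_pair_swap: "f \<in> borel_measurable (P \<Otimes>\<^sub>M Q) \<Longrightarrow>
      (\<integral>z. f (prod.swap z) \<partial>(Q \<Otimes>\<^sub>M P)) = (\<integral>z. f z \<partial>(P \<Otimes>\<^sub>M Q))"
    and borel_measurable_pair_swap: "f \<in> borel_measurable (P \<Otimes>\<^sub>M Q) \<Longrightarrow>
      (\<lambda>z. f (prod.swap z)) \<in> borel_measurable (Q \<Otimes>\<^sub>M P)"
proof -
  interpret pair_sigma_finite P Q using pair_prob[OF P Q] by simp
  have e: "(\<lambda>z. f (prod.swap z)) = (\<lambda>(x, y). f (y, x))" by (auto simp: prod.swap_def)
  show "integrable (P \<Otimes>\<^sub>M Q) f \<Longrightarrow> integrable (Q \<Otimes>\<^sub>M P) (\<lambda>z. f (prod.swap z))"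
    unfolding e by (rule integrable_product_swap)
  show "f \<in> borel_measurable (P \<Otimes>\<^sub>M Q) \<Longrightarrow>
      (\<integral>z. f (prod.swap z) \<partial>(Q \<Otimes>\<^sub>M P)) = (\<integral>z. f z \<partial>(P \<Otimes>\<^sub>M Q))"
    unfolding e by (rule integral_product_swap)
  show "f \<in> borel_measurable (P \<Otimes>\<^sub>M Q) \<Longrightarrow>
      (\<lambda>z. f (prod.swap z)) \<in> borel_measurable (Q \<Otimes>\<^sub>M P)"
    unfolding e by (rule measurable_pair_swap)
qed

lemma L2_space_swap:
  assumes "prob_space P" "prob_space Q" "f \<in> L2_space (P \<Otimes>\<^sub>M Q)"
  shows "(\<lambda>z. f (prod.swap z)) \<in> L2_space (Q \<Otimes>\<^sub>M P)"
  using borel_measurable_pair_swap[OF assms(1,2), of f]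
    integrable_pair_swap[OF assms(1,2), of "\<lambda>z. (f z)\<^sup>2"] assms(3)
  by (simp add: L2_space_def)

lemma L2_norm_swap:
  assumes "prob_space P" "prob_space Q" "f \<in> borel_measurable (P \<Otimes>\<^sub>M Q)"
  shows "L2_norm (Q \<Otimes>\<^sub>M P) (\<lambda>z. f (prod.swap z)) = L2_norm (P \<Otimes>\<^sub>M Q) f"
  using integral_pair_swap[OF assms(1,2), of "\<lambda>z. (f z)\<^sup>2"] assms(3) by (simp add: L2_norm_def)

lemma L2_space_fst:
  assumes "prob_space P" "prob_space Q" "f \<in> L2_space P"
  shows "(\<lambda>z. f (fst z)) \<in> L2_space (P \<Otimes>\<^sub>M Q)"
  using integrable_pair_fst[OF assms(1,2), of "\<lambda>x. (f x)\<^sup>2"] assms(3)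
  by (auto simp: L2_space_def)

lemma L2_norm_fst:
  assumes "prob_space P" "prob_space Q" "f \<in> borel_measurable P"
  shows "L2_norm (P \<Otimes>\<^sub>M Q) (\<lambda>z. f (fst z)) = L2_norm P f"
  using integral_pair_fst[OF assms(1,2), of "\<lambda>x. (f x)\<^sup>2"] assms(3) by (simp add: L2_norm_def)

lemma
  fixes f :: "'b \<Rightarrow> real"
  assumes P: "prob_space P" and Q: "prob_space Q"
  shows L2_space_snd: "f \<in> L2_space Q \<Longrightarrow> (\<lambda>z. f (snd z)) \<in> L2_space (P \<Otimes>\<^sub>M Q)"
    and L2_norm_snd: "f \<in> borel_measurable Q \<Longrightarrow> L2_norm (P \<Otimes>\<^sub>M Q) (\<lambda>z. f (snd z)) = L2_norm Q f"
    and integral_pair_snd: "f \<in> borel_measurable Q \<Longrightarrow> (\<integral>z. f (snd z) \<partial>(P \<Otimes>\<^sub>M Q)) = (\<integral>x. f x \<partial>Q)"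
proof -
  have m: "f \<in> borel_measurable Q \<Longrightarrow> (\<lambda>z. f (fst z)) \<in> borel_measurable (Q \<Otimes>\<^sub>M P)"
    by (rule measurable_compose[OF measurable_fst])
  show "f \<in> L2_space Q \<Longrightarrow> (\<lambda>z. f (snd z)) \<in> L2_space (P \<Otimes>\<^sub>M Q)"
    using L2_space_swap[OF Q P L2_space_fst[OF Q P], of f] by simp
  show "f \<in> borel_measurable Q \<Longrightarrow> L2_norm (P \<Otimes>\<^sub>M Q) (\<lambda>z. f (snd z)) = L2_norm Q f"
    using L2_norm_swap[OF Q P m] L2_norm_fst[OF Q P, of f] by simp
  show "f \<in> borel_measurable Q \<Longrightarrow> (\<integral>z. f (snd z) \<partial>(P \<Otimes>\<^sub>M Q)) = (\<integral>x. f x \<partial>Q)"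
    using integral_pair_swap[OF Q P m] integral_pair_fst[OF Q P, of f] by simp
qed


subsection \<open>Density quotients\<close>

text \<open>Away from the set where the quotient is infinite, \<open>P\<close> has an ordinary
  density with respect to \<open>Q\<close>. Writing this as an equality of measures makes the
  library calculus of \<open>density\<close> applicable.\<close>

lemma density_quotient_finite_part:
  assumes P: "prob_space P" and Q: "prob_space Q" and s: "sets P = sets Q"
  defines "F \<equiv> {x \<in> space Q. density_quotient P Q x < \<infinity>}"
  shows "density_quotient P Q \<in> borel_measurable Q" and "F \<in> sets Q" and "AE x in Q. x \<in> F"
    and "density P (indicator F) = density Q (\<lambda>x. density_quotient P Q x * indicator F x)"
proof -
  interpret Q: prob_space Q by fact
  let ?L = "density_quotient P Q"
  have L: "is_density_quotient P Q ?L"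
    by (rule is_density_quotient_density_quotient[OF P Q s])
  show m[measurable]: "?L \<in> borel_measurable Q"
    using L by (simp add: is_density_quotient_def)
  show F[measurable]: "F \<in> sets Q" unfolding F_def by measurable
  have "emeasure Q F = 1"
    using L by (simp add: is_density_quotient_def F_def)
  then show "AE x in Q. x \<in> F" using Q.AE_in_set_eq_1[OF F] by (simp add: Q.emeasure_eq_measure)
  have FP[measurable]: "F \<in> sets P" using F s by simp
  show "density P (indicator F) = density Q (\<lambda>x. ?L x * indicator F x)"
  proof (rule measure_eqI)
    fix A assume "A \<in> sets (density P (indicator F))"
    then have A[measurable]: "A \<in> sets Q" "A \<in> sets P" using s by auto
    \<comment> \<open>For subsets of \<open>F\<close> the singular term in the defining identity of
      the quotient vanishes.\<close>
    have e: "A \<inter> F \<inter> {x \<in> space Q. ?L x = \<infinity>} = {}" by (auto simp: F_def)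
    have "emeasure (density P (indicator F)) A = emeasure P (A \<inter> F)"
      by (simp add: emeasure_density Int_commute flip: indicator_inter_arith)
    also have "\<dots> = (\<integral>\<^sup>+x. ?L x * indicator (A \<inter> F) x \<partial>Q)"
      using L A(1) F e unfolding is_density_quotient_def by (metis add.right_neutral emeasure_empty sets.Int)
    also have "\<dots> = emeasure (density Q (\<lambda>x. ?L x * indicator F x)) A"
      by (subst emeasure_density) (auto simp: indicator_inter_arith mult_ac)
    finally show "emeasure (density P (indicator F)) A =
        emeasure (density Q (\<lambda>x. ?L x * indicator F x)) A" .
  qed (simp add: s)
qed

text \<open>Restricted to the intersection of \<open>F\<close> with the set \<open>G\<close> where
  the quotient is finite, \<open>P\<close> has two densities with respect to the finite measure
  \<open>Q\<close>. They agree almost everywhere, and the intersection has full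
  \<open>Q\<close>-measure. This is how a chosen quotient is identified with an explicit
  formula.\<close>

lemma density_quotient_AE_unique:
  assumes P: "prob_space P" and Q: "prob_space Q" and s: "sets P = sets Q"
    and L[measurable]: "L \<in> borel_measurable Q"
    and F[measurable]: "F \<in> sets Q" and AE_F: "AE x in Q. x \<in> F"
    and eq: "density P (indicator F) = density Q (\<lambda>x. L x * indicator F x)"
  shows "AE x in Q. density_quotient P Q x = L x"
proof -
  interpret Q: prob_space Q by fact
  let ?D = "density_quotient P Q"
  define G where "G = {x \<in> space Q. ?D x < \<infinity>}"
  note D = density_quotient_finite_part[OF P Q s, folded G_def]
  note [measurable] = D(1,2)
  have [measurable]: "F \<in> sets P" "G \<in> sets P" using s F D(2) by auto
  have "density P (\<lambda>x. indicator F x * indicator G x) = density (density P (indicator F)) (indicator G)"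
    by (rule density_density_eq[symmetric]) measurable
  also have "\<dots> = density Q (\<lambda>x. L x * indicator F x * indicator G x)"
    unfolding eq by (rule density_density_eq) measurable
  finally have 1: "density P (\<lambda>x. indicator F x * indicator G x) =
      density Q (\<lambda>x. L x * indicator F x * indicator G x)" .
  \<comment> \<open>The same restriction of \<open>P\<close> in the other order, now expressed
    through the quotient instead of \<open>L\<close>.\<close>
  have "density P (\<lambda>x. indicator G x * indicator F x) = density (density P (indicator G)) (indicator F)"
    by (rule density_density_eq[symmetric]) measurable
  also have "\<dots> = density Q (\<lambda>x. ?D x * indicator G x * indicator F x)"
    unfolding D(4) by (rule density_density_eq) measurable
  finally have "density Q (\<lambda>x. ?D x * indicator G x * indicator F x) =
      density Q (\<lambda>x. L x * indicator F x * indicator G x)"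
    using 1 by (simp add: mult.commute)
  then have e: "emeasure (density Q (\<lambda>x. ?D x * indicator G x * indicator F x)) A =
      emeasure (density Q (\<lambda>x. L x * indicator F x * indicator G x)) A" for A by simp
  have "AE x in Q. ?D x * indicator G x * indicator F x = L x * indicator F x * indicator G x"
  proof (rule Q.density_unique_finite_measure)
    fix A assume "A \<in> sets Q"
    then show "(\<integral>\<^sup>+x\<in>A. ?D x * indicator G x * indicator F x \<partial>Q) =
        (\<integral>\<^sup>+x\<in>A. L x * indicator F x * indicator G x \<partial>Q)"
      using e[of A] by (simp add: emeasure_density)
  qed auto
  with AE_F D(3) show ?thesis by eventually_elim simp
qed

lemma density_quotient_self: "prob_space Q \<Longrightarrow> AE x in Q. density_quotient Q Q x = 1"
  by (rule density_quotient_AE_unique[where F = "space Q"]) (auto intro!: density_cong)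

text \<open>On the rectangle \<open>F \<times> G\<close>, where both factor quotients are finite,
  the product of the restricted measures has the product of the quotients as density; uniqueness
  then identifies it.\<close>

lemma density_quotient_pair:
  assumes P: "prob_space P" "prob_space P0" "sets P = sets P0"
    and Q: "prob_space Q" "prob_space Q0" "sets Q = sets Q0"
  shows "AE z in P0 \<Otimes>\<^sub>M Q0. density_quotient (P \<Otimes>\<^sub>M Q) (P0 \<Otimes>\<^sub>M Q0) z =
    density_quotient P P0 (fst z) * density_quotient Q Q0 (snd z)"
proof -
  let ?L = "density_quotient P P0" and ?M = "density_quotient Q Q0"
  define F where "F = {x \<in> space P0. ?L x < \<infinity>}"
  define G where "G = {x \<in> space Q0. ?M x < \<infinity>}"
  note F = density_quotient_finite_part[OF P, folded F_def]
  note G = density_quotient_finite_part[OF Q, folded G_def]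
  note [measurable] = F(1,2) G(1,2)
  interpret P: prob_space P by fact
  interpret P0: prob_space P0 by fact
  interpret Q: prob_space Q by fact
  interpret Q0: prob_space Q0 by fact
  interpret PQ0: pair_prob_space P0 Q0 ..
  have [measurable]: "F \<in> sets P" "G \<in> sets Q" using F(2) G(2) P(3) Q(3) by auto
  \<comment> \<open>\<open>pair_measure_density\<close> asks for sigma-finiteness of the second
    measure with density; finiteness is inherited from \<open>Q\<close>.\<close>
  have "finite_measure (density Q (indicator G))"
    by (rule finite_measureI) (simp add: emeasure_density flip: indicator_inter_arith)
  then have sf: "sigma_finite_measure (density Q (indicator G))"
    by (simp add: finite_measure_def)
  show ?thesis
  proof (rule density_quotient_AE_unique)
    show "prob_space (P \<Otimes>\<^sub>M Q)" "prob_space (P0 \<Otimes>\<^sub>M Q0)"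
      using P Q by (auto intro: pair_prob)
    show "sets (P \<Otimes>\<^sub>M Q) = sets (P0 \<Otimes>\<^sub>M Q0)"
      using P(3) Q(3) by (rule sets_pair_measure_cong)
    show "F \<times> G \<in> sets (P0 \<Otimes>\<^sub>M Q0)" by measurable
    have "AE z in P0 \<Otimes>\<^sub>M Q0. fst z \<in> F"
      by (rule AE_distrD[OF measurable_fst]) (subst Q0.distr_pair_fst, rule F(3))
    moreover have "AE z in P0 \<Otimes>\<^sub>M Q0. snd z \<in> G"
      using G(3) F(3) by (intro PQ0.AE_pair_measure) (auto elim: eventually_mono)
    ultimately show "AE z in P0 \<Otimes>\<^sub>M Q0. z \<in> F \<times> G"
      by eventually_elim (auto simp: mem_Times_iff)
    have "density (P \<Otimes>\<^sub>M Q) (indicator (F \<times> G)) = density (P \<Otimes>\<^sub>M Q) (\<lambda>(x, y). indicator F x * indicator G y)"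
      by (rule arg_cong[where f="density _"]) (auto simp: fun_eq_iff indicator_def)
    also have "\<dots> = density P (indicator F) \<Otimes>\<^sub>M density Q (indicator G)"
      by (rule pair_measure_density[symmetric]) (use sf in \<open>auto intro: Q.sigma_finite_measure_axioms\<close>)
    also have "\<dots> = density (P0 \<Otimes>\<^sub>M Q0) (\<lambda>(x, y). (?L x * indicator F x) * (?M y * indicator G y))"
      unfolding F(4) G(4)
      by (rule pair_measure_density)
        (use sf G(4) in \<open>auto intro: Q0.sigma_finite_measure_axioms\<close>)
    also have "\<dots> = density (P0 \<Otimes>\<^sub>M Q0) (\<lambda>z. ?L (fst z) * ?M (snd z) * indicator (F \<times> G) z)"
      by (rule arg_cong[where f="density _"]) (auto simp: fun_eq_iff indicator_def)
    finally show "density (P \<Otimes>\<^sub>M Q) (indicator (F \<times> G)) =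
        density (P0 \<Otimes>\<^sub>M Q0) (\<lambda>z. ?L (fst z) * ?M (snd z) * indicator (F \<times> G) z)" .
  qed measurable
qed

section \<open>Square roots of density quotients\<close>

text \<open>This is the root inside \<open>L2_differentiable_curve\<close>, so unfolding passes
  between the two forms. The value 0 where the quotient is infinite only concerns a
  \<open>Q\<close>-null set when \<open>P\<close> and \<open>Q\<close> are probability measures on
  the same sigma-algebra.\<close>

definition root_density :: "'a measure \<Rightarrow> 'a measure \<Rightarrow> 'a \<Rightarrow> real" where
  "root_density P Q x = sqrt (enn2real (density_quotient P Q x))"

lemma root_density_nonneg: "0 \<le> root_density P Q x"
  by (simp add: root_density_def)

text \<open>Taking the whole space in the defining identity of the quotient splits the mass 1 of
  \<open>P\<close> into the integral of the quotient, which is the squared norm of its root, and the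
  singular mass. The condition on singular mass thus becomes one on norms, and norms multiply under
  products.\<close>

lemma
  assumes P: "prob_space P" and Q: "prob_space Q" and s: "sets P = sets Q"
  shows root_density_L2: "root_density P Q \<in> L2_space Q"
    and singular_part_eq: "measure P {x \<in> space P. density_quotient P Q x = \<infinity>} =
      1 - (L2_norm Q (root_density P Q))\<^sup>2"
proof -
  interpret P: prob_space P by fact
  interpret Q: prob_space Q by fact
  let ?L = "density_quotient P Q"
  define S where "S = {x \<in> space P. ?L x = \<infinity>}"
  note D = density_quotient_finite_part[OF P Q s]
  note [measurable] = D(1)
  have sp: "space P = space Q" using s by (rule sets_eq_imp_space_eq)
  have L: "is_density_quotient P Q ?L"
    by (rule is_density_quotient_density_quotient[OF P Q s])
  then have "emeasure P (space Q) = (\<integral>\<^sup>+x. ?L x * indicator (space Q) x \<partial>Q) +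
      emeasure P (space Q \<inter> {x \<in> space Q. ?L x = \<infinity>})"
    unfolding is_density_quotient_def by blast
  also have "(\<integral>\<^sup>+x. ?L x * indicator (space Q) x \<partial>Q) = (\<integral>\<^sup>+x. ?L x \<partial>Q)"
    by (rule nn_integral_cong) simp
  \<comment> \<open>The quotient is finite \<open>Q\<close>-almost everywhere, so there it equals
    the square of its real root.\<close>
  also have "(\<integral>\<^sup>+x. ?L x \<partial>Q) = (\<integral>\<^sup>+x. ennreal ((root_density P Q x)\<^sup>2) \<partial>Q)"
    by (rule nn_integral_cong_AE, use D(3) in eventually_elim) (auto simp: root_density_def)
  finally have e: "1 = (\<integral>\<^sup>+x. ennreal ((root_density P Q x)\<^sup>2) \<partial>Q) + emeasure P S"
    using P.emeasure_space_1 by (simp add: S_def sp Int_def)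
  have m: "root_density P Q \<in> borel_measurable Q"
    unfolding root_density_def[abs_def] by measurable
  have fin: "(\<integral>\<^sup>+x. ennreal ((root_density P Q x)\<^sup>2) \<partial>Q) < \<infinity>"
    using e by (metis ennreal_add_eq_top ennreal_one_neq_top infinity_ennreal_def top.not_eq_extremum)
  then have i: "integrable Q (\<lambda>x. (root_density P Q x)\<^sup>2)"
    using m by (intro integrableI_nonneg) auto
  then show "root_density P Q \<in> L2_space Q" using m by (simp add: L2_space_def)
  have "ennreal 1 = ennreal ((L2_norm Q (root_density P Q))\<^sup>2) + ennreal (measure P S)"
    using e nn_integral_eq_integral[OF i] by (simp add: L2_norm_sq P.emeasure_eq_measure)
  also have "\<dots> = ennreal ((L2_norm Q (root_density P Q))\<^sup>2 + measure P S)" by simp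
  finally have "1 = (L2_norm Q (root_density P Q))\<^sup>2 + measure P S"
    by (subst (asm) ennreal_inj) auto
  then show "measure P {x \<in> space P. ?L x = \<infinity>} = 1 - (L2_norm Q (root_density P Q))\<^sup>2"
    by (simp add: S_def)
qed

lemma root_density_norm_le_1:
  assumes "prob_space P" "prob_space Q" "sets P = sets Q"
  shows "L2_norm Q (root_density P Q) \<le> 1"
proof -
  have "(L2_norm Q (root_density P Q))\<^sup>2 \<le> 1"
    using singular_part_eq[OF assms] measure_nonneg[of P "{x \<in> space P. density_quotient P Q x = \<infinity>}"]
    by linarith
  then show ?thesis by (rule power2_le_imp_le[of _ 1, simplified])
qed

lemma root_density_pair:
  assumes "prob_space P" "prob_space P0" "sets P = sets P0"
    and "prob_space Q" "prob_space Q0" "sets Q = sets Q0"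
  shows "AE z in P0 \<Otimes>\<^sub>M Q0. root_density (P \<Otimes>\<^sub>M Q) (P0 \<Otimes>\<^sub>M Q0) z =
    root_density P P0 (fst z) * root_density Q Q0 (snd z)"
  using density_quotient_pair[OF assms]
  by eventually_elim (simp add: root_density_def enn2real_mult real_sqrt_mult)

lemma root_density_self: "prob_space Q \<Longrightarrow> AE x in Q. root_density Q Q x = 1"
  using density_quotient_self[of Q] by (auto simp: root_density_def elim: eventually_mono)

text \<open>Fubini for a product of functions of separate variables, applied to \<open>f\<close> and
  \<open>g\<close> and to their squares.\<close>

lemma L2_norm_pair_mult:
  assumes P: "prob_space P" and Q: "prob_space Q" and f: "f \<in> L2_space P" and g: "g \<in> L2_space Q"
  shows "(\<lambda>z. f (fst z) * g (snd z)) \<in> L2_space (P \<Otimes>\<^sub>M Q)"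
    and "L2_norm (P \<Otimes>\<^sub>M Q) (\<lambda>z. f (fst z) * g (snd z)) = L2_norm P f * L2_norm Q g"
    and "(\<integral>z. f (fst z) * g (snd z) \<partial>(P \<Otimes>\<^sub>M Q)) = (\<integral>x. f x \<partial>P) * (\<integral>y. g y \<partial>Q)"
proof -
  interpret pair_prob_space P Q using pair_prob[OF P Q] by simp
  have *: "integrable (P \<Otimes>\<^sub>M Q) (\<lambda>z. u (fst z) * v (snd z)) \<and>
      (\<integral>z. u (fst z) * v (snd z) \<partial>(P \<Otimes>\<^sub>M Q)) = (\<integral>x. u x \<partial>P) * (\<integral>y. v y \<partial>Q)"
    if u: "integrable P u" and v: "integrable Q v" for u :: "'a \<Rightarrow> real" and v :: "'b \<Rightarrow> real"
  proof -
    have "integrable (P \<Otimes>\<^sub>M Q) (\<lambda>z. u (fst z) * v (snd z))"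
      by (rule Fubini_integrable) (use u v in \<open>auto simp: abs_mult\<close>)
    from integral_fst'[OF this] this show ?thesis by simp
  qed
  have m[measurable]: "f \<in> borel_measurable P" "g \<in> borel_measurable Q"
    using f g by (auto dest: L2_spaceD)
  note sq = *[of "\<lambda>x. (f x)\<^sup>2" "\<lambda>x. (g x)\<^sup>2", OF L2_spaceD(2)[OF f] L2_spaceD(2)[OF g]]
  have "(\<lambda>z. f (fst z) * g (snd z)) \<in> borel_measurable (P \<Otimes>\<^sub>M Q)" by measurable
  then show "(\<lambda>z. f (fst z) * g (snd z)) \<in> L2_space (P \<Otimes>\<^sub>M Q)"
    using sq by (simp add: L2_space_def power_mult_distrib)
  show "L2_norm (P \<Otimes>\<^sub>M Q) (\<lambda>z. f (fst z) * g (snd z)) = L2_norm P f * L2_norm Q g"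
    using sq by (simp add: L2_norm_def power_mult_distrib real_sqrt_mult)
  show "(\<integral>z. f (fst z) * g (snd z) \<partial>(P \<Otimes>\<^sub>M Q)) = (\<integral>x. f x \<partial>P) * (\<integral>y. g y \<partial>Q)"
    using *[OF L2_space_integrable[OF P f] L2_space_integrable[OF Q g]] by simp
qed


subsection \<open>Curves in product families\<close>

text \<open>Here \<open>s\<close> and \<open>u\<close> play the roles of the root densities of the
  two factors; with arbitrary functions the estimate can also be used after exchanging the factors.
  On the right, \<open>N\<close> is the remainder of the product curve, the second summand
  corresponds to its singular mass by \<open>singular_part_pair\<close>, and the third bounds the
  squared norm of \<open>w\<close>.\<close>

lemma root_density_estimate:
  fixes t :: real
  assumes P: "prob_space P" and Q: "prob_space Q"
    and s: "s \<in> L2_space P" "L2_norm P s \<le> 1"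
    and u: "u \<in> L2_space Q" "L2_norm Q u \<le> 1" "\<And>y. 0 \<le> u y"
    and g: "g \<in> L2_space (P \<Otimes>\<^sub>M Q)"
  defines "N \<equiv> L2_norm (P \<Otimes>\<^sub>M Q) (\<lambda>z. 2 * (s (fst z) * u (snd z) - 1) - t * g z)"
  shows "L2_norm P (\<lambda>x. 2 * (s x - 1) - t * (\<integral>y. g (x, y) \<partial>Q)) \<le>
    N + (1 - (L2_norm P s * L2_norm Q u)\<^sup>2) + (N + \<bar>t\<bar> * L2_norm (P \<Otimes>\<^sub>M Q) g)\<^sup>2 / 4"
proof -
  interpret pair_prob_space P Q using pair_prob[OF P Q] by simp
  let ?R = "P \<Otimes>\<^sub>M Q"
  define a where "a = (\<integral>y. u y \<partial>Q)"
  define b where "b = (\<integral>x. s x \<partial>P)"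
  define w where "w z = s (fst z) * u (snd z) - 1" for z
  define g1 where "g1 x = (\<integral>y. g (x, y) \<partial>Q)" for x
  have R: "prob_space ?R" by unfold_locales
  note su = L2_norm_pair_mult[OF P Q s(1) u(1)]
  note c1 = L2_space_const[OF R, of 1]
  have a0: "0 \<le> a" using u(3) by (simp add: a_def)
  have b1: "b \<le> 1"
  proof -
    have "b\<^sup>2 \<le> (L2_norm P s)\<^sup>2"
      unfolding b_def L2_norm_sq by (rule square_expectation_le[OF P s(1)])
    then show ?thesis using s(2) L2_norm_nonneg[of P s] power2_le_imp_le by fastforce
  qed
  have w: "w \<in> L2_space ?R" unfolding w_def[abs_def] by (rule L2_space_diff[OF su(1) c1])
  have tg: "(\<lambda>z. t * g z) \<in> L2_space ?R" by (rule L2_space_scale[OF g])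
  have w2: "(\<lambda>z. 2 * w z) \<in> L2_space ?R" by (rule L2_space_scale[OF w])
  have d: "(\<lambda>z. 2 * w z - t * g z) \<in> L2_space ?R" by (rule L2_space_diff[OF w2 tg])
  have N: "N = L2_norm ?R (\<lambda>z. 2 * w z - t * g z)" by (simp add: N_def w_def)
  \<comment> \<open>Expanding the square brings in the mean \<open>a * b\<close> of the product,
    which ties the means to the norms.\<close>
  have "(L2_norm ?R w)\<^sup>2 =
      (\<integral>z. (s (fst z) * u (snd z))\<^sup>2 - 2 * (s (fst z) * u (snd z)) + 1 \<partial>?R)"
    unfolding L2_norm_sq w_def by (simp add: power2_diff algebra_simps)
  also have "\<dots> = (L2_norm P s * L2_norm Q u)\<^sup>2 - 2 * (a * b) + 1"
    using L2_spaceD(2)[OF su(1)] L2_space_integrable[OF R su(1)] su(2,3) L2_norm_sq[of ?R, symmetric]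
    by (simp add: prob_space a_def b_def mult.commute)
  finally have "2 * (1 - a * b) = (L2_norm ?R w)\<^sup>2 + (1 - (L2_norm P s * L2_norm Q u)\<^sup>2)" by simp
  \<comment> \<open>Triangle inequality for 2 w = (2 w - t g) + t g.\<close>
  moreover have "(L2_norm ?R w)\<^sup>2 \<le> (N + \<bar>t\<bar> * L2_norm ?R g)\<^sup>2 / 4"
  proof -
    have "2 * L2_norm ?R w = L2_norm ?R (\<lambda>z. (2 * w z - t * g z) + t * g z)"
      using L2_norm_scale[of ?R 2 w] by simp
    also have "\<dots> \<le> N + \<bar>t\<bar> * L2_norm ?R g"
      using L2_norm_triangle[OF d tg] by (simp add: N L2_norm_scale)
    finally have "(2 * L2_norm ?R w)\<^sup>2 \<le> (N + \<bar>t\<bar> * L2_norm ?R g)\<^sup>2"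
      by (rule power_mono) (simp add: L2_norm_nonneg)
    then show ?thesis by (simp add: power_mult_distrib)
  qed
  moreover have "a * b \<le> a" using mult_left_mono[OF b1 a0] by simp
  moreover have "2 * (1 - a * b) = X + Y \<Longrightarrow> X \<le> Z \<Longrightarrow> a * b \<le> a \<Longrightarrow> 2 * (1 - a) \<le> Y + Z"
    for X Y Z by (simp add: algebra_simps)
  ultimately have a_le: "2 * (1 - a) \<le>
      (1 - (L2_norm P s * L2_norm Q u)\<^sup>2) + (N + \<bar>t\<bar> * L2_norm ?R g)\<^sup>2 / 4" by blast
  have a1: "a \<le> 1"
  proof -
    have "a\<^sup>2 \<le> (L2_norm Q u)\<^sup>2"
      unfolding a_def L2_norm_sq by (rule square_expectation_le[OF Q u(1)])
    then show ?thesis using u(2) L2_norm_nonneg[of Q u] power2_le_imp_le by fastforce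
  qed
  have g1: "g1 \<in> L2_space P" unfolding g1_def[abs_def] by (rule partial_integral_L2[OF P Q g])
  have e: "(\<lambda>x. 2 * (a * s x - 1) - t * g1 x) \<in> L2_space P"
    by (intro L2_space_diff L2_space_scale s g1 L2_space_const P)
  have as: "(\<lambda>x. (2 * (1 - a)) * s x) \<in> L2_space P" by (rule L2_space_scale[OF s(1)])
  \<comment> \<open>Integrating the product remainder over \<open>y\<close> turns \<open>u\<close>
    into its mean \<open>a\<close>. The equality is only almost everywhere because \<open>g\<close>
    has integrable sections only for almost every \<open>x\<close>.\<close>
  have "L2_norm P (\<lambda>x. 2 * (a * s x - 1) - t * g1 x) =
      L2_norm P (\<lambda>x. \<integral>y. 2 * w (x, y) - t * g (x, y) \<partial>Q)"
  proof (rule L2_norm_cong_AE)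
    have iu: "integrable Q u" by (rule L2_space_integrable[OF Q u(1)])
    show "AE x in P. 2 * (a * s x - 1) - t * g1 x = (\<integral>y. 2 * w (x, y) - t * g (x, y) \<partial>Q)"
      using AE_integrable_fst'[OF L2_space_integrable[OF R g]]
    proof eventually_elim
      case (elim x)
      then show ?case
        using iu by (simp add: w_def g1_def a_def M2.prob_space)
    qed
  qed (use e partial_integral_L2[OF P Q d] in \<open>auto dest: L2_spaceD\<close>)
  also have "\<dots> \<le> N" unfolding N by (rule L2_norm_partial_integral[OF P Q d])
  finally have "L2_norm P (\<lambda>x. 2 * (a * s x - 1) - t * g1 x) \<le> N" .
  moreover have "L2_norm P (\<lambda>x. (2 * (1 - a)) * s x) \<le> 2 * (1 - a)"
    using a1 s(2) unfolding L2_norm_scale by (simp add: mult_left_le)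
  moreover have "L2_norm P (\<lambda>x. 2 * (s x - 1) - t * g1 x) \<le>
      L2_norm P (\<lambda>x. 2 * (a * s x - 1) - t * g1 x) + L2_norm P (\<lambda>x. (2 * (1 - a)) * s x)"
  proof -
    \<comment> \<open>Replacing \<open>a * s x\<close> by \<open>s x\<close> costs the term
      \<open>2 * (1 - a) * s x\<close>, whose norm is at most \<open>2 * (1 - a)\<close>.\<close>
    have "(\<lambda>x. 2 * (s x - 1) - t * g1 x) =
        (\<lambda>x. (2 * (a * s x - 1) - t * g1 x) + (2 * (1 - a)) * s x)"
      by (simp add: fun_eq_iff algebra_simps)
    then show ?thesis using L2_norm_triangle[OF e as] by (simp only:)
  qed
  ultimately have "L2_norm P (\<lambda>x. 2 * (s x - 1) - t * g1 x) \<le> N + 2 * (1 - a)" by linarith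
  also have "\<dots> \<le> N + ((1 - (L2_norm P s * L2_norm Q u)\<^sup>2) + (N + \<bar>t\<bar> * L2_norm ?R g)\<^sup>2 / 4)"
    using a_le by (rule add_left_mono)
  finally show ?thesis by (simp only: g1_def add.assoc)
qed

section \<open>Marginals of curves in a product family\<close>

text \<open>Both conditions on a curve of product measures are expressed through the root densities
  of the factors, which agree with the root of the product quotient almost everywhere.\<close>

lemma
  assumes P: "prob_space P" "prob_space P0" "sets P = sets P0"
    and Q: "prob_space Q" "prob_space Q0" "sets Q = sets Q0"
  shows L2_norm_root_density_pair: "g \<in> borel_measurable (P0 \<Otimes>\<^sub>M Q0) \<Longrightarrow>
      L2_norm (P0 \<Otimes>\<^sub>M Q0) (\<lambda>z. 2 * (root_density (P \<Otimes>\<^sub>M Q) (P0 \<Otimes>\<^sub>M Q0) z - 1) - t * g z) =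
      L2_norm (P0 \<Otimes>\<^sub>M Q0) (\<lambda>z. 2 * (root_density P P0 (fst z) * root_density Q Q0 (snd z) - 1) - t * g z)"
    and singular_part_pair: "measure (P \<Otimes>\<^sub>M Q)
        {z \<in> space (P \<Otimes>\<^sub>M Q). density_quotient (P \<Otimes>\<^sub>M Q) (P0 \<Otimes>\<^sub>M Q0) z = \<infinity>} =
      1 - (L2_norm P0 (root_density P P0) * L2_norm Q0 (root_density Q Q0))\<^sup>2"
proof -
  have pr: "prob_space (P \<Otimes>\<^sub>M Q)" "prob_space (P0 \<Otimes>\<^sub>M Q0)" "sets (P \<Otimes>\<^sub>M Q) = sets (P0 \<Otimes>\<^sub>M Q0)"
    using P Q by (auto intro: pair_prob sets_pair_measure_cong)
  note m = L2_spaceD(1)[OF root_density_L2[OF pr]]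
  note l2 = root_density_L2[OF P] root_density_L2[OF Q]
  note m' = L2_spaceD(1)[OF L2_norm_pair_mult(1)[OF P(2) Q(2) l2]]
  note ae = root_density_pair[OF P Q]
  show "L2_norm (P0 \<Otimes>\<^sub>M Q0) (\<lambda>z. 2 * (root_density (P \<Otimes>\<^sub>M Q) (P0 \<Otimes>\<^sub>M Q0) z - 1) - t * g z) =
      L2_norm (P0 \<Otimes>\<^sub>M Q0) (\<lambda>z. 2 * (root_density P P0 (fst z) * root_density Q Q0 (snd z) - 1) - t * g z)"
    if [measurable]: "g \<in> borel_measurable (P0 \<Otimes>\<^sub>M Q0)"
  proof (rule L2_norm_cong_AE)
    note [measurable] = m m'
    show "AE z in P0 \<Otimes>\<^sub>M Q0. 2 * (root_density (P \<Otimes>\<^sub>M Q) (P0 \<Otimes>\<^sub>M Q0) z - 1) - t * g z =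
        2 * (root_density P P0 (fst z) * root_density Q Q0 (snd z) - 1) - t * g z"
      using ae by eventually_elim simp
  qed (use m m' that in \<open>auto intro!: borel_measurable_diff borel_measurable_times\<close>)
  show "measure (P \<Otimes>\<^sub>M Q) {z \<in> space (P \<Otimes>\<^sub>M Q). density_quotient (P \<Otimes>\<^sub>M Q) (P0 \<Otimes>\<^sub>M Q0) z = \<infinity>} =
      1 - (L2_norm P0 (root_density P P0) * L2_norm Q0 (root_density Q Q0))\<^sup>2"
    unfolding singular_part_eq[OF pr] L2_norm_cong_AE[OF ae m m'] L2_norm_pair_mult(2)[OF P(2) Q(2) l2] ..
qed

text \<open>The bound has the shape of \<open>root_density_estimate\<close> with \<open>c\<close>
  the norm of the tangent. Its squared term is of order t^2, hence negligible against |t|, as is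
  \<open>S\<close>.\<close>

lemma marginal_smallo:
  fixes N S :: "real \<Rightarrow> real"
  assumes N: "N \<in> o[at 0](\<lambda>t. \<bar>t\<bar>)" and S: "S \<in> o[at 0](\<lambda>t. t\<^sup>2)"
    and bd: "eventually (\<lambda>t. \<bar>n t\<bar> \<le> N t + S t + (N t + \<bar>t\<bar> * c)\<^sup>2 / 4) (at 0)"
  shows "n \<in> o[at 0](\<lambda>t. \<bar>t\<bar>)"
proof -
  have sq: "(\<lambda>t::real. t\<^sup>2) \<in> o[at 0](\<lambda>t. \<bar>t\<bar>)" by real_asymp
  have "(\<lambda>t. \<bar>t\<bar> * c) \<in> O[at 0](\<lambda>t. \<bar>t\<bar>)" by simp
  then have "(\<lambda>t. N t + \<bar>t\<bar> * c) \<in> O[at 0](\<lambda>t. \<bar>t\<bar>)"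
    using N by (intro sum_in_bigo) (auto intro: landau_o.small_imp_big)
  then have "(\<lambda>t. (N t + \<bar>t\<bar> * c)\<^sup>2) \<in> O[at 0](\<lambda>t. \<bar>t\<bar>\<^sup>2)"
    by (rule landau_o.big_power)
  then have "(\<lambda>t. (N t + \<bar>t\<bar> * c)\<^sup>2) \<in> O[at 0](\<lambda>t. t\<^sup>2)" by simp
  then have "(\<lambda>t. (N t + \<bar>t\<bar> * c)\<^sup>2 / 4) \<in> o[at 0](\<lambda>t. \<bar>t\<bar>)"
    using landau_o.big_small_trans[OF _ sq] by simp
  moreover have "S \<in> o[at 0](\<lambda>t. \<bar>t\<bar>)"
    using landau_o.small_trans[OF S sq] .
  ultimately have "(\<lambda>t. N t + S t + (N t + \<bar>t\<bar> * c)\<^sup>2 / 4) \<in> o[at 0](\<lambda>t. \<bar>t\<bar>)"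
    using N by (intro sum_in_smallo)
  moreover have "n \<in> O[at 0](\<lambda>t. N t + S t + (N t + \<bar>t\<bar> * c)\<^sup>2 / 4)"
    using bd by (intro bigoI[of _ 1]) (auto elim!: eventually_mono)
  ultimately show ?thesis by (rule landau_o.big_small_trans[rotated])
qed

lemma eventually_in_interval_at_0:
  assumes "\<And>t. t \<in> {-\<epsilon><..<\<epsilon>} \<Longrightarrow> Pr t" and "0 < (\<epsilon>::real)"
  shows "eventually Pr (at 0)"
  unfolding eventually_at using assms(2)
  by (intro exI[of _ \<epsilon>]) (auto simp: dist_real_def abs_less_iff intro!: assms(1))

lemma prob_algebra_family:
  assumes "\<P> \<subseteq> space (prob_algebra M)" "P \<in> \<P>"
  shows "prob_space P" "P' \<in> \<P> \<Longrightarrow> sets P = sets P'"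
proof -
  show "prob_space P" using assms by (auto simp: space_prob_algebra)
  show "sets P = sets P'" if "P' \<in> \<P>"
    using subsetD[OF assms(1) assms(2)] subsetD[OF assms(1) that] by (simp add: space_prob_algebra)
qed

text \<open>The remainders of the two marginals are controlled by
  \<open>root_density_estimate\<close>, applied once in each order of the factors; their singular
  masses are dominated by that of the product.\<close>

lemma
  assumes Ps: "\<P> \<subseteq> space (prob_algebra M1)" and Qs: "\<Q> \<subseteq> space (prob_algebra M2)"
    and R: "L2_differentiable_curve \<R> \<epsilon> R g"
    and PQ: "\<And>t. t \<in> {-\<epsilon><..<\<epsilon>} \<Longrightarrow> P t \<in> \<P> \<and> Q t \<in> \<Q> \<and> R t = P t \<Otimes>\<^sub>M Q t"
  shows marginal_curve_fst: "L2_differentiable_curve \<P> \<epsilon> P (\<lambda>x. \<integral>y. g (x, y) \<partial>Q 0)"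
    and marginal_curve_snd: "L2_differentiable_curve \<Q> \<epsilon> Q (\<lambda>y. \<integral>x. g (x, y) \<partial>P 0)"
proof -
  have \<epsilon>: "\<epsilon> > 0" using R by (simp add: L2_differentiable_curve_def)
  have P0: "P 0 \<in> \<P>" and Q0: "Q 0 \<in> \<Q>" and R0: "R 0 = P 0 \<Otimes>\<^sub>M Q 0"
    using PQ[of 0] \<epsilon> by auto
  have p: "prob_space (P t)" "prob_space (P 0)" "sets (P t) = sets (P 0)"
    and q: "prob_space (Q t)" "prob_space (Q 0)" "sets (Q t) = sets (Q 0)"
    if "t \<in> {-\<epsilon><..<\<epsilon>}" for t
    using prob_algebra_family[OF Ps] prob_algebra_family[OF Qs] PQ[OF that] P0 Q0 by blast+
  have p0: "prob_space (P 0)" and q0: "prob_space (Q 0)" using p[of 0] q[of 0] \<epsilon> by auto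
  have g: "g \<in> L2_space (P 0 \<Otimes>\<^sub>M Q 0)"
    using R by (simp add: L2_differentiable_curve_def R0)
  note g' = L2_space_swap[OF p0 q0 g]
  define N where "N t = L2_norm (R 0) (\<lambda>z. 2 * (root_density (R t) (R 0) z - 1) - t * g z)" for t
  define S where "S t = measure (R t) {z \<in> space (R t). density_quotient (R t) (R 0) z = \<infinity>}" for t
  have N: "N \<in> o[at 0](\<lambda>t. \<bar>t\<bar>)" and S: "S \<in> o[at 0](\<lambda>t. t\<^sup>2)"
    using R unfolding L2_differentiable_curve_def N_def[abs_def] S_def[abs_def] root_density_def
    by blast+
  define s where "s t = root_density (P t) (P 0)" for t
  define u where "u t = root_density (Q t) (Q 0)" for t
  define Sp where "Sp t = measure (P t) {x \<in> space (P t). density_quotient (P t) (P 0) x = \<infinity>}" for t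
  define Sq where "Sq t = measure (Q t) {x \<in> space (Q t). density_quotient (Q t) (Q 0) x = \<infinity>}" for t
  have N_eq: "N t = L2_norm (P 0 \<Otimes>\<^sub>M Q 0) (\<lambda>z. 2 * (s t (fst z) * u t (snd z) - 1) - t * g z)"
    and S_eq: "S t = 1 - (L2_norm (P 0) (s t) * L2_norm (Q 0) (u t))\<^sup>2"
    and s: "s t \<in> L2_space (P 0)" "L2_norm (P 0) (s t) \<le> 1" "\<And>x. 0 \<le> s t x"
    and u: "u t \<in> L2_space (Q 0)" "L2_norm (Q 0) (u t) \<le> 1" "\<And>y. 0 \<le> u t y"
    and Sp: "Sp t = 1 - (L2_norm (P 0) (s t))\<^sup>2" and Sq: "Sq t = 1 - (L2_norm (Q 0) (u t))\<^sup>2"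
    if t: "t \<in> {-\<epsilon><..<\<epsilon>}" for t
  proof -
    have Rt: "R t = P t \<Otimes>\<^sub>M Q t" using PQ[OF t] by blast
    show "N t = L2_norm (P 0 \<Otimes>\<^sub>M Q 0) (\<lambda>z. 2 * (s t (fst z) * u t (snd z) - 1) - t * g z)"
      unfolding N_def Rt R0 s_def u_def
      by (rule L2_norm_root_density_pair[OF p[OF t] q[OF t] L2_spaceD(1)[OF g]])
    show "S t = 1 - (L2_norm (P 0) (s t) * L2_norm (Q 0) (u t))\<^sup>2"
      unfolding S_def Rt R0 s_def u_def by (rule singular_part_pair[OF p[OF t] q[OF t]])
    show "s t \<in> L2_space (P 0)" "L2_norm (P 0) (s t) \<le> 1" "0 \<le> s t x" for x
      unfolding s_def
      by (rule root_density_L2[OF p[OF t]] root_density_norm_le_1[OF p[OF t]] root_density_nonneg)+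
    show "u t \<in> L2_space (Q 0)" "L2_norm (Q 0) (u t) \<le> 1" "0 \<le> u t y" for y
      unfolding u_def
      by (rule root_density_L2[OF q[OF t]] root_density_norm_le_1[OF q[OF t]] root_density_nonneg)+
    show "Sp t = 1 - (L2_norm (P 0) (s t))\<^sup>2"
      unfolding Sp_def s_def by (rule singular_part_eq[OF p[OF t]])
    show "Sq t = 1 - (L2_norm (Q 0) (u t))\<^sup>2"
      unfolding Sq_def u_def by (rule singular_part_eq[OF q[OF t]])
  qed
  \<comment> \<open>Both norms are at most 1, so their product is at most each of them; squaring and
    subtracting from 1 reverses the inequality.\<close>
  have sing: "Sp t \<le> S t" "Sq t \<le> S t" if t: "t \<in> {-\<epsilon><..<\<epsilon>}" for t
  proof -
    have "L2_norm (P 0) (s t) * L2_norm (Q 0) (u t) \<le> L2_norm (P 0) (s t)"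
      "L2_norm (P 0) (s t) * L2_norm (Q 0) (u t) \<le> L2_norm (Q 0) (u t)"
      using s[OF t] u[OF t] by (auto simp: L2_norm_nonneg mult_left_le mult_left_le_one_le)
    then show "Sp t \<le> S t" "Sq t \<le> S t"
      unfolding Sp[OF t] Sq[OF t] S_eq[OF t] by (auto intro!: power_mono mult_nonneg_nonneg L2_norm_nonneg)
  qed
  have Np: "L2_norm (P 0) (\<lambda>x. 2 * (s t x - 1) - t * (\<integral>y. g (x, y) \<partial>Q 0)) \<le>
      N t + S t + (N t + \<bar>t\<bar> * L2_norm (P 0 \<Otimes>\<^sub>M Q 0) g)\<^sup>2 / 4" if t: "t \<in> {-\<epsilon><..<\<epsilon>}" for t
    using root_density_estimate[OF p0 q0 s(1,2)[OF t] u[OF t] g, of t]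
    unfolding N_eq[OF t] S_eq[OF t] .
  \<comment> \<open>The estimate is applied to \<open>u\<close>, \<open>s\<close> and the swapped
    tangent; exchanging coordinates preserves the norms that occur in it.\<close>
  have Nq: "L2_norm (Q 0) (\<lambda>y. 2 * (u t y - 1) - t * (\<integral>x. g (x, y) \<partial>P 0)) \<le>
      N t + S t + (N t + \<bar>t\<bar> * L2_norm (P 0 \<Otimes>\<^sub>M Q 0) g)\<^sup>2 / 4" if t: "t \<in> {-\<epsilon><..<\<epsilon>}" for t
  proof -
    have m: "(\<lambda>z. 2 * (s t (fst z) * u t (snd z) - 1) - t * g z) \<in> borel_measurable (P 0 \<Otimes>\<^sub>M Q 0)"
      by (rule L2_spaceD(1), intro L2_space_diff L2_space_scale g L2_space_const
          L2_norm_pair_mult(1) p0 q0 s(1)[OF t] u(1)[OF t] pair_prob(3))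
    have "N t = L2_norm (Q 0 \<Otimes>\<^sub>M P 0) (\<lambda>z. 2 * (u t (fst z) * s t (snd z) - 1) - t * g (prod.swap z))"
      using L2_norm_swap[OF p0 q0 m] by (simp add: N_eq[OF t] mult.commute)
    moreover have "S t = 1 - (L2_norm (Q 0) (u t) * L2_norm (P 0) (s t))\<^sup>2"
      by (simp add: S_eq[OF t] mult.commute)
    ultimately show ?thesis
      using root_density_estimate[OF q0 p0 u(1,2)[OF t] s[OF t] g', of t]
        L2_norm_swap[OF p0 q0 L2_spaceD(1)[OF g]]
      by simp
  qed
  have "(\<lambda>t. L2_norm (P 0) (\<lambda>x. 2 * (s t x - 1) - t * (\<integral>y. g (x, y) \<partial>Q 0))) \<in> o[at 0](\<lambda>t. \<bar>t\<bar>)"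
    by (rule marginal_smallo[OF N S], rule eventually_in_interval_at_0[OF _ \<epsilon>])
      (use Np in \<open>simp add: L2_norm_nonneg\<close>)
  moreover have "(\<lambda>t. L2_norm (Q 0) (\<lambda>y. 2 * (u t y - 1) - t * (\<integral>x. g (x, y) \<partial>P 0))) \<in> o[at 0](\<lambda>t. \<bar>t\<bar>)"
    by (rule marginal_smallo[OF N S], rule eventually_in_interval_at_0[OF _ \<epsilon>])
      (use Nq in \<open>simp add: L2_norm_nonneg\<close>)
  moreover have "Sp \<in> o[at 0](\<lambda>t. t\<^sup>2)"
    by (rule landau_o.big_small_trans[OF bigoI[of _ 1] S], rule eventually_in_interval_at_0[OF _ \<epsilon>])
      (use sing in \<open>simp add: Sp_def S_def\<close>)
  moreover have "Sq \<in> o[at 0](\<lambda>t. t\<^sup>2)"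
    by (rule landau_o.big_small_trans[OF bigoI[of _ 1] S], rule eventually_in_interval_at_0[OF _ \<epsilon>])
      (use sing in \<open>simp add: Sq_def S_def\<close>)
  moreover have "(\<lambda>y. \<integral>x. g (x, y) \<partial>P 0) \<in> L2_space (Q 0)"
    using partial_integral_L2[OF q0 p0 g'] by simp
  ultimately show "L2_differentiable_curve \<P> \<epsilon> P (\<lambda>x. \<integral>y. g (x, y) \<partial>Q 0)"
    and "L2_differentiable_curve \<Q> \<epsilon> Q (\<lambda>y. \<integral>x. g (x, y) \<partial>P 0)"
    using \<epsilon> PQ partial_integral_L2[OF p0 q0 g]
    unfolding L2_differentiable_curve_def s_def u_def root_density_def Sp_def[abs_def] Sq_def[abs_def]
    by blast+
qed

section \<open>Curves with one factor held fixed\<close>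

text \<open>A criterion for product curves that involves only the root densities of the factors. The
  formulas for product measures hold for \<open>t\<close> in the interval, which suffices for
  conditions as \<open>t\<close> tends to 0.\<close>

lemma product_curve:
  assumes Ps: "\<P> \<subseteq> space (prob_algebra M1)" and Qs: "\<Q> \<subseteq> space (prob_algebra M2)"
    and \<epsilon>: "\<epsilon> > 0" and PQ: "\<And>t. t \<in> {-\<epsilon><..<\<epsilon>} \<Longrightarrow> P t \<in> \<P> \<and> Q t \<in> \<Q>"
    and g: "g \<in> L2_space (P 0 \<Otimes>\<^sub>M Q 0)"
    and N: "(\<lambda>t. L2_norm (P 0 \<Otimes>\<^sub>M Q 0) (\<lambda>z. 2 * (root_density (P t) (P 0) (fst z) *
        root_density (Q t) (Q 0) (snd z) - 1) - t * g z)) \<in> o[at 0](\<lambda>t. \<bar>t\<bar>)"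
    and S: "(\<lambda>t. 1 - (L2_norm (P 0) (root_density (P t) (P 0)) *
        L2_norm (Q 0) (root_density (Q t) (Q 0)))\<^sup>2) \<in> o[at 0](\<lambda>t. t\<^sup>2)"
  shows "L2_differentiable_curve (product_family \<P> \<Q>) \<epsilon> (\<lambda>t. P t \<Otimes>\<^sub>M Q t) g"
proof -
  have P0: "P 0 \<in> \<P>" and Q0: "Q 0 \<in> \<Q>" using PQ[of 0] \<epsilon> by auto
  have p: "prob_space (P t)" "prob_space (P 0)" "sets (P t) = sets (P 0)"
    and q: "prob_space (Q t)" "prob_space (Q 0)" "sets (Q t) = sets (Q 0)"
    if "t \<in> {-\<epsilon><..<\<epsilon>}" for t
    using prob_algebra_family[OF Ps] prob_algebra_family[OF Qs] PQ[OF that] P0 Q0 by blast+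
  have "(\<lambda>t. L2_norm (P 0 \<Otimes>\<^sub>M Q 0)
      (\<lambda>z. 2 * (root_density (P t \<Otimes>\<^sub>M Q t) (P 0 \<Otimes>\<^sub>M Q 0) z - 1) - t * g z)) \<in> o[at 0](\<lambda>t. \<bar>t\<bar>)"
    by (subst landau_o.small.in_cong[OF eventually_in_interval_at_0[OF _ \<epsilon>]])
      (rule L2_norm_root_density_pair, rule p, assumption, rule p, assumption, rule p, assumption,
       rule q, assumption, rule q, assumption, rule q, assumption, rule L2_spaceD[OF g], rule N)
  moreover have "(\<lambda>t. measure (P t \<Otimes>\<^sub>M Q t) {z \<in> space (P t \<Otimes>\<^sub>M Q t).
      density_quotient (P t \<Otimes>\<^sub>M Q t) (P 0 \<Otimes>\<^sub>M Q 0) z = \<infinity>}) \<in> o[at 0](\<lambda>t. t\<^sup>2)"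
    by (subst landau_o.small.in_cong[OF eventually_in_interval_at_0[OF _ \<epsilon>]])
      (rule singular_part_pair, rule p, assumption, rule p, assumption, rule p, assumption,
       rule q, assumption, rule q, assumption, rule q, assumption, rule S)
  ultimately show ?thesis
    using \<epsilon> PQ g unfolding L2_differentiable_curve_def root_density_def product_family_def by blast
qed

text \<open>The curve conditions in terms of \<open>root_density\<close>; singular mass is replaced
  by 1 minus a squared norm, the form matching \<open>product_curve\<close>.\<close>

lemma L2_differentiable_curveD:
  assumes "\<R> \<subseteq> space (prob_algebra M)" and "L2_differentiable_curve \<R> \<epsilon> R h"
  shows "\<epsilon> > 0" "t \<in> {-\<epsilon><..<\<epsilon>} \<Longrightarrow> R t \<in> \<R>" "h \<in> L2_space (R 0)"
    and "(\<lambda>t. L2_norm (R 0) (\<lambda>x. 2 * (root_density (R t) (R 0) x - 1) - t * h x)) \<in> o[at 0](\<lambda>t. \<bar>t\<bar>)"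
    and "(\<lambda>t. 1 - (L2_norm (R 0) (root_density (R t) (R 0)))\<^sup>2) \<in> o[at 0](\<lambda>t. t\<^sup>2)"
    and "prob_space (R 0)"
    and "t \<in> {-\<epsilon><..<\<epsilon>} \<Longrightarrow> root_density (R t) (R 0) \<in> borel_measurable (R 0)"
proof -
  show \<epsilon>: "\<epsilon> > 0"
    using assms(2) unfolding L2_differentiable_curve_def by blast
  show R: "R t \<in> \<R>" if "t \<in> {-\<epsilon><..<\<epsilon>}" for t
    using assms(2) that unfolding L2_differentiable_curve_def by blast
  have R0: "R 0 \<in> \<R>" using R[of 0] \<epsilon> by simp
  then show p: "prob_space (R 0)" by (rule prob_algebra_family(1)[OF assms(1)])
  have r: "prob_space (R t)" "prob_space (R 0)" "sets (R t) = sets (R 0)"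
    if "t \<in> {-\<epsilon><..<\<epsilon>}" for t
    using prob_algebra_family[OF assms(1)] R[OF that] R0 by blast+
  show "t \<in> {-\<epsilon><..<\<epsilon>} \<Longrightarrow> root_density (R t) (R 0) \<in> borel_measurable (R 0)"
    using root_density_L2[OF r] by (blast intro: L2_spaceD)
  show "h \<in> L2_space (R 0)"
    and "(\<lambda>t. L2_norm (R 0) (\<lambda>x. 2 * (root_density (R t) (R 0) x - 1) - t * h x)) \<in> o[at 0](\<lambda>t. \<bar>t\<bar>)"
    using assms(2) unfolding L2_differentiable_curve_def root_density_def by blast+
  show "(\<lambda>t. 1 - (L2_norm (R 0) (root_density (R t) (R 0)))\<^sup>2) \<in> o[at 0](\<lambda>t. t\<^sup>2)"
    by (subst landau_o.small.in_cong[OF eventually_in_interval_at_0[OF _ \<epsilon>]])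
      (rule singular_part_eq[symmetric], rule r, assumption, rule r, assumption, rule r, assumption,
       use assms(2) in \<open>simp add: L2_differentiable_curve_def\<close>)
qed

lemma L2_norm_root_density_self:
  assumes R: "prob_space R"
  shows "L2_norm R (root_density R R) = 1"
proof -
  have "L2_norm R (root_density R R) = L2_norm R (\<lambda>_. 1)"
    by (rule L2_norm_cong_AE[OF root_density_self[OF R]])
      (auto intro: L2_spaceD root_density_L2 R)
  then show ?thesis using prob_space.prob_space[OF R] by (simp add: L2_norm_def)
qed

text \<open>The constant factor has root density 1 almost everywhere and of norm 1, so both
  conditions reduce to those of the moving factor. These curves supply the tangents needed for the
  canonical gradient.\<close>

lemma
  assumes Ps: "\<P> \<subseteq> space (prob_algebra M1)" and Qs: "\<Q> \<subseteq> space (prob_algebra M2)"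
  shows product_curve_fst: "L2_differentiable_curve \<P> \<epsilon> P h \<Longrightarrow> Q0 \<in> \<Q> \<Longrightarrow>
      L2_differentiable_curve (product_family \<P> \<Q>) \<epsilon> (\<lambda>t. P t \<Otimes>\<^sub>M Q0) (\<lambda>z. h (fst z))"
    and product_curve_snd: "L2_differentiable_curve \<Q> \<epsilon> Q h' \<Longrightarrow> P0 \<in> \<P> \<Longrightarrow>
      L2_differentiable_curve (product_family \<P> \<Q>) \<epsilon> (\<lambda>t. P0 \<Otimes>\<^sub>M Q t) (\<lambda>z. h' (snd z))"
proof -
  assume C: "L2_differentiable_curve \<P> \<epsilon> P h" and Q0: "Q0 \<in> \<Q>"
  note c = L2_differentiable_curveD[OF Ps C]
  note p = c(6)
  note q = prob_algebra_family(1)[OF Qs Q0]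
  interpret pair_prob_space "P 0" Q0 using pair_prob[OF p q] by simp
  have [measurable]: "root_density Q0 Q0 \<in> borel_measurable Q0" "h \<in> borel_measurable (P 0)"
    using root_density_L2[OF q q refl] c(3) by (blast dest: L2_spaceD)+
  have ae: "AE z in P 0 \<Otimes>\<^sub>M Q0. root_density Q0 Q0 (snd z) = 1"
    by (rule AE_pair_measure) (use root_density_self[OF q] in simp_all)
  show "L2_differentiable_curve (product_family \<P> \<Q>) \<epsilon> (\<lambda>t. P t \<Otimes>\<^sub>M Q0) (\<lambda>z. h (fst z))"
  proof (rule product_curve[OF Ps Qs c(1)])
    have N: "L2_norm (P 0 \<Otimes>\<^sub>M Q0) (\<lambda>z. 2 * (root_density (P t) (P 0) (fst z) *
          root_density Q0 Q0 (snd z) - 1) - t * h (fst z)) =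
        L2_norm (P 0) (\<lambda>x. 2 * (root_density (P t) (P 0) x - 1) - t * h x)"
      if t: "t \<in> {-\<epsilon><..<\<epsilon>}" for t
    proof -
      note [measurable] = c(7)[OF t]
      have "L2_norm (P 0 \<Otimes>\<^sub>M Q0) (\<lambda>z. 2 * (root_density (P t) (P 0) (fst z) *
          root_density Q0 Q0 (snd z) - 1) - t * h (fst z)) =
        L2_norm (P 0 \<Otimes>\<^sub>M Q0) (\<lambda>z. 2 * (root_density (P t) (P 0) (fst z) - 1) - t * h (fst z))"
        by (rule L2_norm_cong_AE, use ae in eventually_elim) simp_all
      also have "\<dots> = L2_norm (P 0) (\<lambda>x. 2 * (root_density (P t) (P 0) x - 1) - t * h x)"
        by (rule L2_norm_fst[OF p q]) measurable
      finally show ?thesis .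
    qed
    show "(\<lambda>t. L2_norm (P 0 \<Otimes>\<^sub>M Q0) (\<lambda>z. 2 * (root_density (P t) (P 0) (fst z) *
        root_density Q0 Q0 (snd z) - 1) - t * h (fst z))) \<in> o[at 0](\<lambda>t. \<bar>t\<bar>)"
      by (subst landau_o.small.in_cong[OF eventually_in_interval_at_0[OF N c(1)]]) (assumption, rule c)
    show "(\<lambda>t. 1 - (L2_norm (P 0) (root_density (P t) (P 0)) *
        L2_norm Q0 (root_density Q0 Q0))\<^sup>2) \<in> o[at 0](\<lambda>t. t\<^sup>2)"
      using c(5) by (simp only: L2_norm_root_density_self[OF q] mult_1_right)
  qed (use c(2) Q0 L2_space_fst[OF p q c(3)] in blast)+
next
  assume C: "L2_differentiable_curve \<Q> \<epsilon> Q h'" and P0: "P0 \<in> \<P>"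
  note c = L2_differentiable_curveD[OF Qs C]
  note q = c(6)
  note p = prob_algebra_family(1)[OF Ps P0]
  interpret M2: prob_space "Q 0" by (rule q)
  have [measurable]: "root_density P0 P0 \<in> borel_measurable P0" "h' \<in> borel_measurable (Q 0)"
    using root_density_L2[OF p p refl] c(3) by (blast dest: L2_spaceD)+
  have ae: "AE z in P0 \<Otimes>\<^sub>M Q 0. root_density P0 P0 (fst z) = 1"
    by (rule AE_distrD[OF measurable_fst]) (subst M2.distr_pair_fst, rule root_density_self[OF p])
  show "L2_differentiable_curve (product_family \<P> \<Q>) \<epsilon> (\<lambda>t. P0 \<Otimes>\<^sub>M Q t) (\<lambda>z. h' (snd z))"
  proof (rule product_curve[OF Ps Qs c(1)])
    have N: "L2_norm (P0 \<Otimes>\<^sub>M Q 0) (\<lambda>z. 2 * (root_density P0 P0 (fst z) *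
          root_density (Q t) (Q 0) (snd z) - 1) - t * h' (snd z)) =
        L2_norm (Q 0) (\<lambda>x. 2 * (root_density (Q t) (Q 0) x - 1) - t * h' x)"
      if t: "t \<in> {-\<epsilon><..<\<epsilon>}" for t
    proof -
      note [measurable] = c(7)[OF t]
      have "L2_norm (P0 \<Otimes>\<^sub>M Q 0) (\<lambda>z. 2 * (root_density P0 P0 (fst z) *
          root_density (Q t) (Q 0) (snd z) - 1) - t * h' (snd z)) =
        L2_norm (P0 \<Otimes>\<^sub>M Q 0) (\<lambda>z. 2 * (root_density (Q t) (Q 0) (snd z) - 1) - t * h' (snd z))"
        by (rule L2_norm_cong_AE, use ae in eventually_elim) simp_all
      also have "\<dots> = L2_norm (Q 0) (\<lambda>x. 2 * (root_density (Q t) (Q 0) x - 1) - t * h' x)"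
        by (rule L2_norm_snd[OF p q]) measurable
      finally show ?thesis .
    qed
    show "(\<lambda>t. L2_norm (P0 \<Otimes>\<^sub>M Q 0) (\<lambda>z. 2 * (root_density P0 P0 (fst z) *
        root_density (Q t) (Q 0) (snd z) - 1) - t * h' (snd z))) \<in> o[at 0](\<lambda>t. \<bar>t\<bar>)"
      by (subst landau_o.small.in_cong[OF eventually_in_interval_at_0[OF N c(1)]]) (assumption, rule c)
    show "(\<lambda>t. 1 - (L2_norm P0 (root_density P0 P0) *
        L2_norm (Q 0) (root_density (Q t) (Q 0)))\<^sup>2) \<in> o[at 0](\<lambda>t. t\<^sup>2)"
      using c(5) by (simp only: L2_norm_root_density_self[OF p] mult_1_left)
  qed (use c(2) P0 L2_space_snd[OF p q c(3)] in blast)+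
qed


subsection \<open>Linear spans and tangent spaces\<close>

lemma linear_span_base: "g \<in> S \<Longrightarrow> g \<in> linear_span S"
  unfolding linear_span_def by (intro CollectI exI[of _ "\<lambda>_. 1"] exI[of _ "{g}"]) auto

lemma linear_span_zero: "(\<lambda>x. 0) \<in> linear_span S"
  unfolding linear_span_def by (intro CollectI exI[of _ "\<lambda>_. 1"] exI[of _ "{}"]) auto

lemma linear_span_scale:
  assumes "f \<in> linear_span S"
  shows "(\<lambda>x. c * f x) \<in> linear_span S"
proof -
  obtain d F where "finite F" "F \<subseteq> S" "f = (\<lambda>x. \<Sum>g\<in>F. d g * g x)"
    using assms unfolding linear_span_def by blast
  then show ?thesis
    unfolding linear_span_def
    by (intro CollectI exI[of _ "\<lambda>g. c * d g"] exI[of _ F]) (simp add: sum_distrib_left mult.assoc)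
qed

lemma linear_span_add:
  assumes "f \<in> linear_span S" "f' \<in> linear_span S"
  shows "(\<lambda>x. f x + f' x) \<in> linear_span S"
proof -
  obtain c F where F: "finite F" "F \<subseteq> S" "f = (\<lambda>x. \<Sum>g\<in>F. c g * g x)"
    using assms(1) unfolding linear_span_def by blast
  obtain d G where G: "finite G" "G \<subseteq> S" "f' = (\<lambda>x. \<Sum>g\<in>G. d g * g x)"
    using assms(2) unfolding linear_span_def by blast
  \<comment> \<open>Both coefficient families are extended by 0 to the union, so generators
    occurring in both sums receive the sum of their coefficients.\<close>
  let ?e = "\<lambda>g. (if g \<in> F then c g else 0) + (if g \<in> G then d g else 0)"
  have "f x + f' x = (\<Sum>g\<in>F \<union> G. ?e g * g x)" for x
  proof -
    have "(\<Sum>g\<in>F. c g * g x) = (\<Sum>g\<in>F \<union> G. (if g \<in> F then c g else 0) * g x)"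
      using F(1) G(1) by (intro sum.mono_neutral_cong_left) auto
    moreover have "(\<Sum>g\<in>G. d g * g x) = (\<Sum>g\<in>F \<union> G. (if g \<in> G then d g else 0) * g x)"
      using F(1) G(1) by (intro sum.mono_neutral_cong_left) auto
    ultimately show ?thesis
      unfolding F(3) G(3) by (simp only: distrib_right sum.distrib)
  qed
  then have "(\<lambda>x. f x + f' x) = (\<lambda>x. \<Sum>g\<in>F \<union> G. ?e g * g x)" by blast
  then show ?thesis
    unfolding linear_span_def using F G by (intro CollectI exI[of _ ?e] exI[of _ "F \<union> G"]) simp
qed

text \<open>Induction on the number of generators, so that later proofs need no explicit finite
  sums.\<close>

lemma linear_span_induct [consumes 1, case_names zero add]:
  assumes f: "f \<in> linear_span S"
    and zero: "Pr (\<lambda>x. 0)"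
    and add: "\<And>c g h. g \<in> S \<Longrightarrow> Pr h \<Longrightarrow> Pr (\<lambda>x. c * g x + h x)"
  shows "Pr f"
proof -
  obtain c F where F: "finite F" "F \<subseteq> S" "f = (\<lambda>x. \<Sum>g\<in>F. c g * g x)"
    using f unfolding linear_span_def by blast
  from F(1,2) have "Pr (\<lambda>x. \<Sum>g\<in>F. c g * g x)"
  proof (induction F)
    case (insert g F)
    then have "Pr (\<lambda>x. c g * g x + (\<Sum>g\<in>F. c g * g x))" by (intro add) auto
    then show ?case using insert.hyps by simp
  qed (simp add: zero)
  then show ?thesis by (simp only: F(3))
qed

text \<open>Used with \<open>\<pi>\<close> a coordinate projection, to lift spans of tangents from a
  factor to the product.\<close>

lemma linear_span_compose:
  assumes "f \<in> linear_span S" and S: "\<And>g. g \<in> S \<Longrightarrow> (\<lambda>z. g (\<pi> z)) \<in> T"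
  shows "(\<lambda>z. f (\<pi> z)) \<in> linear_span T"
  using assms(1)
proof (induction rule: linear_span_induct)
  case (add c g h)
  show ?case
    by (rule linear_span_add[OF linear_span_scale[OF linear_span_base[OF S[OF add(1)]]] add(2)])
qed (rule linear_span_zero)

lemma linear_span_L2:
  assumes "S \<subseteq> L2_space R" "f \<in> linear_span S"
  shows "f \<in> L2_space R"
  using assms(2)
proof (induction rule: linear_span_induct)
  case (add c g h)
  then show ?case using assms(1) by (intro L2_space_add L2_space_scale) auto
qed (simp add: L2_space_def)

section \<open>Tangent spaces of product families and canonical gradients\<close>

lemma tangent_cone_L2: "tangent_cone R \<R> \<subseteq> L2_space R"
  unfolding tangent_cone_def L2_differentiable_curve_def by blast

text \<open>Tangents of a factor lift to tangents of the product by holding the other factor fixed.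
  Lifting preserves norms, so approximations by linear combinations lift as well.\<close>

lemma tangent_space_product:
  assumes Ps: "\<P> \<subseteq> space (prob_algebra M1)" and Qs: "\<Q> \<subseteq> space (prob_algebra M2)"
    and P0: "P0 \<in> \<P>" and Q0: "Q0 \<in> \<Q>"
    and f: "f \<in> tangent_space P0 \<P>" and g: "g \<in> tangent_space Q0 \<Q>"
  shows "(\<lambda>z. c * f (fst z) + d * g (snd z)) \<in> tangent_space (P0 \<Otimes>\<^sub>M Q0) (product_family \<P> \<Q>)"
proof -
  let ?R = "P0 \<Otimes>\<^sub>M Q0" and ?K = "tangent_cone (P0 \<Otimes>\<^sub>M Q0) (product_family \<P> \<Q>)"
  note p = prob_algebra_family(1)[OF Ps P0] and q = prob_algebra_family(1)[OF Qs Q0]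
  have Kf: "(\<lambda>z. h (fst z)) \<in> ?K" if "h \<in> tangent_cone P0 \<P>" for h
    using that product_curve_fst[OF Ps Qs _ Q0] unfolding tangent_cone_def by blast
  have Kg: "(\<lambda>z. h (snd z)) \<in> ?K" if "h \<in> tangent_cone Q0 \<Q>" for h
    using that product_curve_snd[OF Ps Qs _ P0] unfolding tangent_cone_def by blast
  have fL: "f \<in> L2_space P0" and gL: "g \<in> L2_space Q0"
    using f g unfolding tangent_space_def L2_closure_def by blast+
  show ?thesis
    unfolding tangent_space_def L2_closure_def
  proof (intro CollectI conjI allI impI)
    show "(\<lambda>z. c * f (fst z) + d * g (snd z)) \<in> L2_space ?R"
      by (intro L2_space_add L2_space_scale L2_space_fst L2_space_snd p q fL gL)
    fix e :: real assume "e > 0"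
    \<comment> \<open>The summand 1 keeps the divisor positive when \<open>c\<close> and
      \<open>d\<close> vanish and makes the final inequality strict.\<close>
    define \<delta> where "\<delta> = e / (\<bar>c\<bar> + \<bar>d\<bar> + 1)"
    have \<delta>: "\<delta> > 0" using \<open>e > 0\<close> by (simp add: \<delta>_def)
    obtain s where s: "s \<in> linear_span (tangent_cone P0 \<P>)" "L2_norm P0 (\<lambda>x. f x - s x) < \<delta>"
      using f \<delta> unfolding tangent_space_def L2_closure_def by blast
    obtain u where u: "u \<in> linear_span (tangent_cone Q0 \<Q>)" "L2_norm Q0 (\<lambda>x. g x - u x) < \<delta>"
      using g \<delta> unfolding tangent_space_def L2_closure_def by blast
    let ?v = "\<lambda>z. c * s (fst z) + d * u (snd z)"
    have v: "?v \<in> linear_span ?K"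
      by (intro linear_span_add linear_span_scale linear_span_compose[OF s(1) Kf]
          linear_span_compose[OF u(1) Kg])
    have d1: "(\<lambda>x. f x - s x) \<in> L2_space P0" and d2: "(\<lambda>x. g x - u x) \<in> L2_space Q0"
      using linear_span_L2[OF tangent_cone_L2] s(1) u(1) fL gL by (blast intro: L2_space_diff)+
    have "L2_norm ?R (\<lambda>z. c * f (fst z) + d * g (snd z) - ?v z) =
        L2_norm ?R (\<lambda>z. c * (f (fst z) - s (fst z)) + d * (g (snd z) - u (snd z)))"
      by (rule arg_cong[where f="L2_norm ?R"]) (simp add: fun_eq_iff algebra_simps)
    also have "\<dots> \<le> L2_norm ?R (\<lambda>z. c * (f (fst z) - s (fst z))) +
        L2_norm ?R (\<lambda>z. d * (g (snd z) - u (snd z)))"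
      by (intro L2_norm_triangle L2_space_scale L2_space_fst[OF p q d1] L2_space_snd[OF p q d2])
    also have "\<dots> = \<bar>c\<bar> * L2_norm P0 (\<lambda>x. f x - s x) + \<bar>d\<bar> * L2_norm Q0 (\<lambda>x. g x - u x)"
      using L2_norm_fst[OF p q L2_spaceD(1)[OF d1]] L2_norm_snd[OF p q L2_spaceD(1)[OF d2]]
      by (simp add: L2_norm_scale)
    also have "\<dots> \<le> \<bar>c\<bar> * \<delta> + \<bar>d\<bar> * \<delta>"
      using s(2) u(2) by (intro add_mono mult_left_mono) auto
    also have "\<dots> < (\<bar>c\<bar> + \<bar>d\<bar> + 1) * \<delta>" using \<delta> by (simp add: algebra_simps)
    also have "\<dots> = e" by (simp add: \<delta>_def)
    finally show "\<exists>v\<in>linear_span ?K. L2_norm ?R (\<lambda>z. c * f (fst z) + d * g (snd z) - v z) < e"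
      by (rule bexI[OF _ v])
  qed
qed

text \<open>Orthogonality passes from the cone to its span by linearity and from there to the
  closure by Cauchy-Schwarz.\<close>

lemma orthogonal_tangent_space:
  assumes d: "d \<in> L2_space R"
    and orth: "\<And>g. g \<in> tangent_cone R \<R> \<Longrightarrow> (\<integral>x. d x * g x \<partial>R) = 0"
    and h: "h \<in> tangent_space R \<R>"
  shows "(\<integral>x. d x * h x \<partial>R) = 0"
proof -
  have hL: "h \<in> L2_space R" using h unfolding tangent_space_def L2_closure_def by blast
  have span: "s \<in> L2_space R \<and> (\<integral>x. d x * s x \<partial>R) = 0" if "s \<in> linear_span (tangent_cone R \<R>)" for s
    using that
  proof (induction rule: linear_span_induct)
    case (add c g h)
    have gL: "g \<in> L2_space R" using add(1) tangent_cone_L2 by blast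
    have e: "(\<lambda>x. d x * (c * g x + h x)) = (\<lambda>x. c * (d x * g x) + d x * h x)"
      by (simp add: fun_eq_iff algebra_simps)
    show ?case
      unfolding e
      using integrable_mult_L2[OF d gL] integrable_mult_L2[OF d conjunct1[OF add(2)]] orth[OF add(1)] add(2)
        L2_space_add[OF L2_space_scale[OF gL, of c] conjunct1[OF add(2)]] by simp
  qed (simp add: L2_space_def)
  have "\<bar>\<integral>x. d x * h x \<partial>R\<bar> \<le> 0 + e" if e: "e > 0" for e :: real
  proof -
    \<comment> \<open>Adding 1 avoids division by 0 when \<open>d\<close> has norm 0.\<close>
    define \<delta> where "\<delta> = e / (L2_norm R d + 1)"
    have \<delta>: "\<delta> > 0" using e L2_norm_nonneg[of R d] by (simp add: \<delta>_def)
    obtain s where s: "s \<in> linear_span (tangent_cone R \<R>)" "L2_norm R (\<lambda>x. h x - s x) < \<delta>"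
      using h \<delta> unfolding tangent_space_def L2_closure_def by blast
    have sL: "s \<in> L2_space R" and s0: "(\<integral>x. d x * s x \<partial>R) = 0" using span[OF s(1)] by auto
    have "(\<integral>x. d x * (h x - s x) \<partial>R) = (\<integral>x. d x * h x \<partial>R)"
      using integrable_mult_L2[OF d hL] integrable_mult_L2[OF d sL] s0 by (simp add: right_diff_distrib)
    then have "\<bar>\<integral>x. d x * h x \<partial>R\<bar> \<le> L2_norm R d * L2_norm R (\<lambda>x. h x - s x)"
      using L2_Cauchy_Schwarz[OF d L2_space_diff[OF hL sL]] by simp
    also have "\<dots> \<le> (L2_norm R d + 1) * \<delta>"
      using s(2) L2_norm_nonneg \<delta> by (intro mult_mono) (auto simp: less_imp_le)
    also have "\<dots> = e" using L2_norm_nonneg[of R d] by (simp add: \<delta>_def)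
    finally show ?thesis by simp
  qed
  then have "\<bar>\<integral>x. d x * h x \<partial>R\<bar> \<le> 0" by (rule field_le_epsilon)
  then show ?thesis by simp
qed

text \<open>Both integrals are limits of the same difference quotient.\<close>

lemma gradient_inner_tangent_unique:
  assumes "is_gradient k \<R> R \<kappa>" "is_gradient k \<R> R \<kappa>'" "g \<in> tangent_cone R \<R>"
  shows "(\<integral>x. \<kappa> x * g x \<partial>R) = (\<integral>x. \<kappa>' x * g x \<partial>R)"
proof -
  obtain \<epsilon> C where "L2_differentiable_curve \<R> \<epsilon> C g" "C 0 = R"
    using assms(3) unfolding tangent_cone_def by blast
  then have "((\<lambda>t. (k (C t) - k (C 0)) / t) \<longlongrightarrow> (\<integral>x. \<kappa> x * g x \<partial>R)) (at_right 0)"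
    "((\<lambda>t. (k (C t) - k (C 0)) / t) \<longlongrightarrow> (\<integral>x. \<kappa>' x * g x \<partial>R)) (at_right 0)"
    using assms(1,2) unfolding is_gradient_def by blast+
  then show ?thesis by (rule tendsto_unique[OF trivial_limit_at_right_real])
qed

lemma is_canonical_gradientI:
  assumes \<kappa>: "is_gradient k \<R> R \<kappa>" "\<kappa> \<in> tangent_space R \<R>"
  shows "is_canonical_gradient k \<R> R \<kappa>"
  unfolding is_canonical_gradient_def
proof (intro conjI allI impI \<kappa>, elim conjE)
  fix \<kappa>' assume \<kappa>': "is_gradient k \<R> R \<kappa>'" "\<kappa>' \<in> tangent_space R \<R>"
  have L: "\<kappa> \<in> L2_space R" "\<kappa>' \<in> L2_space R"
    using \<kappa>(1) \<kappa>'(1) unfolding is_gradient_def L2_zero_space_def by blast+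
  let ?d = "\<lambda>x. \<kappa>' x - \<kappa> x"
  have d: "?d \<in> L2_space R" by (rule L2_space_diff[OF L(2,1)])
  have cone: "(\<integral>x. ?d x * g x \<partial>R) = 0" if g: "g \<in> tangent_cone R \<R>" for g
  proof -
    have gL: "g \<in> L2_space R" using g tangent_cone_L2 by blast
    show ?thesis
      using gradient_inner_tangent_unique[OF \<kappa>(1) \<kappa>'(1) g]
        integrable_mult_L2[OF L(1) gL] integrable_mult_L2[OF L(2) gL] by (simp add: left_diff_distrib)
  qed
  have orth: "(\<integral>x. ?d x * h x \<partial>R) = 0" if "h \<in> tangent_space R \<R>" for h
    by (rule orthogonal_tangent_space[OF d cone that])
  \<comment> \<open>The square of the difference is split into two products with
    \<open>\<kappa>'\<close> and \<open>\<kappa>\<close>, each orthogonal to the difference; closure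
    of the tangent space under subtraction is thereby avoided.\<close>
  have "(\<integral>x. (?d x)\<^sup>2 \<partial>R) = (\<integral>x. ?d x * \<kappa>' x - ?d x * \<kappa> x \<partial>R)"
    by (simp only: power2_eq_square right_diff_distrib)
  also have "\<dots> = 0"
    using orth[OF \<kappa>'(2)] orth[OF \<kappa>(2)] integrable_mult_L2[OF d L(1)] integrable_mult_L2[OF d L(2)]
    by simp
  finally have "AE x in R. (?d x)\<^sup>2 = 0"
    using integral_nonneg_eq_0_iff_AE[OF L2_spaceD(2)[OF d]] by simp
  then show "AE x in R. \<kappa>' x = \<kappa> x" by (rule eventually_mono) simp
qed


subsection \<open>The gradient\<close>

lemma integral_pair_fst_mult:
  assumes P: "prob_space P" and Q: "prob_space Q"
    and f: "f \<in> L2_space P" and g: "g \<in> L2_space (P \<Otimes>\<^sub>M Q)"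
  shows "(\<integral>z. f (fst z) * g z \<partial>(P \<Otimes>\<^sub>M Q)) = (\<integral>x. f x * (\<integral>y. g (x, y) \<partial>Q) \<partial>P)"
proof -
  interpret pair_prob_space P Q using pair_prob[OF P Q] by simp
  show ?thesis
    using integral_fst'[OF integrable_mult_L2[OF L2_space_fst[OF P Q f] g]] by simp
qed

lemma integral_pair_snd_mult:
  assumes P: "prob_space P" and Q: "prob_space Q"
    and f: "f \<in> L2_space Q" and g: "g \<in> L2_space (P \<Otimes>\<^sub>M Q)"
  shows "(\<integral>z. f (snd z) * g z \<partial>(P \<Otimes>\<^sub>M Q)) = (\<integral>y. f y * (\<integral>x. g (x, y) \<partial>P) \<partial>Q)"
proof -
  have "(\<lambda>z. f (snd z) * g z) \<in> borel_measurable (P \<Otimes>\<^sub>M Q)"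
    by (rule borel_measurable_integrable[OF integrable_mult_L2[OF L2_space_snd[OF P Q f] g]])
  from integral_pair_swap[OF P Q this]
  show ?thesis
    using integral_pair_fst_mult[OF Q P f L2_space_swap[OF P Q g]] by simp
qed

section \<open>Chain rule and gradient of the product functional\<close>

text \<open>A one-sided limit of difference quotients is a derivative within the right half-line, so
  the usual chain rule applies once \<open>f\<close> is differentiable at the point itself.\<close>

lemma chain_rule_at_right:
  fixes f :: "real \<times> real \<Rightarrow> real" and a b :: "real \<Rightarrow> real"
  assumes f: "f differentiable (at (a 0, b 0))"
    and a: "((\<lambda>t. (a t - a 0) / t) \<longlongrightarrow> A) (at_right 0)"
    and b: "((\<lambda>t. (b t - b 0) / t) \<longlongrightarrow> B) (at_right 0)"
  shows "((\<lambda>t. (f (a t, b t) - f (a 0, b 0)) / t) \<longlongrightarrow>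
    deriv (\<lambda>x. f (x, b 0)) (a 0) * A + deriv (\<lambda>y. f (a 0, y)) (b 0) * B) (at_right 0)"
proof -
  obtain f' where f': "(f has_derivative f') (at (a 0, b 0))"
    using f unfolding differentiable_def by blast
  interpret f': bounded_linear f' by (rule has_derivative_bounded_linear[OF f'])
  \<comment> \<open>The total derivative is determined by its values on the two unit vectors, which
    are then identified as the partial derivatives.\<close>
  have c: "f' (x, y) = x * f' (1, 0) + y * f' (0, 1)" for x y
    using f'.add[of "x *\<^sub>R (1, 0)" "y *\<^sub>R (0, 1)"] unfolding f'.scaleR by simp
  have "((\<lambda>x. f (x, b 0)) has_derivative (\<lambda>h. f' (h, 0))) (at (a 0))"
    by (rule has_derivative_compose[where g = f and f = "\<lambda>x. (x, b 0)"])
      (auto intro!: derivative_eq_intros f')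
  then have "((\<lambda>x. f (x, b 0)) has_field_derivative f' (1, 0)) (at (a 0))"
    unfolding has_field_derivative_def by (subst (asm) c) (simp add: mult.commute[of _ "f' (1, 0)"])
  then have 1: "deriv (\<lambda>x. f (x, b 0)) (a 0) = f' (1, 0)" by (rule DERIV_imp_deriv)
  have "((\<lambda>y. f (a 0, y)) has_derivative (\<lambda>h. f' (0, h))) (at (b 0))"
    by (rule has_derivative_compose[where g = f and f = "\<lambda>y. (a 0, y)"])
      (auto intro!: derivative_eq_intros f')
  then have "((\<lambda>y. f (a 0, y)) has_field_derivative f' (0, 1)) (at (b 0))"
    unfolding has_field_derivative_def by (subst (asm) c) (simp add: mult.commute[of _ "f' (0, 1)"])
  then have 2: "deriv (\<lambda>y. f (a 0, y)) (b 0) = f' (0, 1)" by (rule DERIV_imp_deriv)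
  have "(a has_field_derivative A) (at_right 0)" "(b has_field_derivative B) (at_right 0)"
    using a b by (simp_all add: has_field_derivative_iff)
  then have "((\<lambda>t. (a t, b t)) has_derivative (\<lambda>h. (A * h, B * h))) (at_right 0)"
    unfolding has_field_derivative_def by (rule has_derivative_Pair)
  from has_derivative_compose[OF this, of f f'] f'
  have "((\<lambda>t. f (a t, b t)) has_derivative (\<lambda>h. f' (A * h, B * h))) (at_right 0)" by simp
  moreover have "(\<lambda>h. f' (A * h, B * h)) = (*) (f' (1, 0) * A + f' (0, 1) * B)"
    by (rule ext) (subst c, simp add: algebra_simps)
  ultimately have "((\<lambda>t. f (a t, b t)) has_field_derivative (f' (1, 0) * A + f' (0, 1) * B)) (at_right 0)"
    by (simp only: has_field_derivative_def)
  then show ?thesis by (simp add: has_field_derivative_iff 1 2)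
qed

text \<open>Along any curve in the product family, the marginal curves give the derivatives of
  \<open>k1\<close> and \<open>k2\<close>. The chain rule combines them, and Fubini turns integrals
  against marginal tangents into integrals against \<open>g\<close>.\<close>

lemma is_gradient_product:
  fixes f :: "real \<times> real \<Rightarrow> real"
  assumes Ps: "\<P> \<subseteq> space (prob_algebra M1)" and Qs: "\<Q> \<subseteq> space (prob_algebra M2)"
    and P0: "P0 \<in> \<P>" and Q0: "Q0 \<in> \<Q>"
    and \<kappa>1: "is_gradient k1 \<P> P0 \<kappa>1" and \<kappa>2: "is_gradient k2 \<Q> Q0 \<kappa>2"
    and f: "f differentiable (at (k1 P0, k2 Q0))"
    and c1: "c1 = deriv (\<lambda>x. f (x, k2 Q0)) (k1 P0)"
    and c2: "c2 = deriv (\<lambda>y. f (k1 P0, y)) (k2 Q0)"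
    and k: "\<And>P Q. P \<in> \<P> \<Longrightarrow> Q \<in> \<Q> \<Longrightarrow> k (P \<Otimes>\<^sub>M Q) = f (k1 P, k2 Q)"
  shows "is_gradient k (product_family \<P> \<Q>) (P0 \<Otimes>\<^sub>M Q0) (\<lambda>z. c1 * \<kappa>1 (fst z) + c2 * \<kappa>2 (snd z))"
proof -
  let ?R = "P0 \<Otimes>\<^sub>M Q0" and ?\<kappa> = "\<lambda>z. c1 * \<kappa>1 (fst z) + c2 * \<kappa>2 (snd z)"
  note p = prob_algebra_family(1)[OF Ps P0] and q = prob_algebra_family(1)[OF Qs Q0]
  have L: "\<kappa>1 \<in> L2_space P0" "\<kappa>2 \<in> L2_space Q0"
    and z: "(\<integral>x. \<kappa>1 x \<partial>P0) = 0" "(\<integral>x. \<kappa>2 x \<partial>Q0) = 0"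
    using \<kappa>1 \<kappa>2 unfolding is_gradient_def L2_zero_space_def by blast+
  note L' = L2_space_fst[OF p q L(1)] L2_space_snd[OF p q L(2)]
  have R: "prob_space ?R" using pair_prob[OF p q] by simp
  have "?\<kappa> \<in> L2_zero_space ?R"
    using L2_space_add[OF L2_space_scale[OF L'(1), of c1] L2_space_scale[OF L'(2), of c2]]
      L2_space_integrable[OF R L'(1)] L2_space_integrable[OF R L'(2)]
      integral_pair_fst[OF p q L2_spaceD(1)[OF L(1)]] integral_pair_snd[OF p q L2_spaceD(1)[OF L(2)]] z
    by (simp add: L2_zero_space_def)
  moreover have "((\<lambda>t. (k (R t) - k (R 0)) / t) \<longlongrightarrow> (\<integral>z. ?\<kappa> z * g z \<partial>?R)) (at_right 0)"
    if C: "L2_differentiable_curve (product_family \<P> \<Q>) \<epsilon> R g" and R0: "R 0 = ?R" for \<epsilon> R g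
  proof -
    have \<epsilon>: "\<epsilon> > 0" and mem: "\<And>t. t \<in> {-\<epsilon><..<\<epsilon>} \<Longrightarrow> R t \<in> product_family \<P> \<Q>"
      and g: "g \<in> L2_space ?R"
      using C unfolding L2_differentiable_curve_def R0 by blast+
    from mem have "\<forall>t\<in>{-\<epsilon><..<\<epsilon>}. \<exists>PQ. fst PQ \<in> \<P> \<and> snd PQ \<in> \<Q> \<and> R t = fst PQ \<Otimes>\<^sub>M snd PQ"
      unfolding product_family_def by force
    \<comment> \<open>The factors are selected separately for each \<open>t\<close>; that the
      selections form differentiable curves is what the marginal lemmas provide.\<close>
    from bchoice[OF this] obtain PQ where
      PQ: "\<forall>t\<in>{-\<epsilon><..<\<epsilon>}. fst (PQ t) \<in> \<P> \<and> snd (PQ t) \<in> \<Q> \<and> R t = fst (PQ t) \<Otimes>\<^sub>M snd (PQ t)"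
      by blast
    define P where "P t = fst (PQ t)" for t
    define Q where "Q t = snd (PQ t)" for t
    have PQ: "P t \<in> \<P> \<and> Q t \<in> \<Q> \<and> R t = P t \<Otimes>\<^sub>M Q t" if "t \<in> {-\<epsilon><..<\<epsilon>}" for t
      unfolding P_def Q_def using PQ that by blast
    \<comment> \<open>A product of probability measures determines its factors, so the selected
      curves start at \<open>P0\<close> and \<open>Q0\<close>.\<close>
    have 0: "P 0 = P0 \<and> Q 0 = Q0"
      using PQ[of 0] \<epsilon> R0 P0 Q0 Ps Qs by (intro pair_prob_measure_inject[of _ M1 _ _ M2]) auto
    have "L2_differentiable_curve \<P> \<epsilon> P (\<lambda>x. \<integral>y. g (x, y) \<partial>Q0)"
      "L2_differentiable_curve \<Q> \<epsilon> Q (\<lambda>y. \<integral>x. g (x, y) \<partial>P0)"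
      using marginal_curve_fst[OF Ps Qs C PQ] marginal_curve_snd[OF Ps Qs C PQ] 0 by auto
    then have "((\<lambda>t. (k1 (P t) - k1 (P 0)) / t) \<longlongrightarrow> (\<integral>x. \<kappa>1 x * (\<integral>y. g (x, y) \<partial>Q0) \<partial>P0)) (at_right 0)"
      "((\<lambda>t. (k2 (Q t) - k2 (Q 0)) / t) \<longlongrightarrow> (\<integral>y. \<kappa>2 y * (\<integral>x. g (x, y) \<partial>P0) \<partial>Q0)) (at_right 0)"
      using \<kappa>1 \<kappa>2 0 unfolding is_gradient_def by blast+
    from chain_rule_at_right[OF _ this] f
    have "((\<lambda>t. (f (k1 (P t), k2 (Q t)) - f (k1 (P 0), k2 (Q 0))) / t) \<longlongrightarrow>
        c1 * (\<integral>x. \<kappa>1 x * (\<integral>y. g (x, y) \<partial>Q0) \<partial>P0) +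
        c2 * (\<integral>y. \<kappa>2 y * (\<integral>x. g (x, y) \<partial>P0) \<partial>Q0)) (at_right 0)"
      by (simp add: 0 c1 c2)
    also have "c1 * (\<integral>x. \<kappa>1 x * (\<integral>y. g (x, y) \<partial>Q0) \<partial>P0) +
        c2 * (\<integral>y. \<kappa>2 y * (\<integral>x. g (x, y) \<partial>P0) \<partial>Q0) =
        c1 * (\<integral>z. \<kappa>1 (fst z) * g z \<partial>?R) + c2 * (\<integral>z. \<kappa>2 (snd z) * g z \<partial>?R)"
      by (simp only: integral_pair_fst_mult[OF p q L(1) g] integral_pair_snd_mult[OF p q L(2) g])
    also have "\<dots> = (\<integral>z. ?\<kappa> z * g z \<partial>?R)"
      using integrable_mult_L2[OF L'(1) g] integrable_mult_L2[OF L'(2) g]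
      by (simp add: distrib_right mult.assoc)
    finally show ?thesis
    proof (rule Lim_transform_eventually)
      \<comment> \<open>The value of \<open>k\<close> is prescribed only on products of members of
        the families, hence along the curve only inside its interval. This covers 0 and all small
        positive \<open>t\<close>.\<close>
      have "k (R t) = f (k1 (P t), k2 (Q t))" if "t \<in> {-\<epsilon><..<\<epsilon>}" for t
        using PQ[OF that] k by simp
      then show "eventually (\<lambda>t. (f (k1 (P t), k2 (Q t)) - f (k1 (P 0), k2 (Q 0))) / t =
          (k (R t) - k (R 0)) / t) (at_right 0)"
        using \<epsilon> by (intro eventually_at_rightI[of 0 \<epsilon>]) auto
    qed
  qed
  ultimately show ?thesis unfolding is_gradient_def by blast
qed

theorem mainTheorem2:
  fixes M1 :: "'a measure" and M2 :: "'b measure"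
    and \<P> :: "'a measure set" and \<Q> :: "'b measure set"
    and P0 :: "'a measure" and Q0 :: "'b measure"
    and k1 :: "'a measure \<Rightarrow> real" and k2 :: "'b measure \<Rightarrow> real"
    and k1_dot k1_tilde :: "'a \<Rightarrow> real" and k2_dot k2_tilde :: "'b \<Rightarrow> real"
    and U :: "(real \<times> real) set" and f :: "real \<times> real \<Rightarrow> real"
    and c1 c2 :: real and k :: "('a \<times> 'b) measure \<Rightarrow> real"
  assumes "\<P> \<subseteq> space (prob_algebra M1)" and "\<P> \<noteq> {}"
    and "\<Q> \<subseteq> space (prob_algebra M2)" and "\<Q> \<noteq> {}"
    and "P0 \<in> \<P>" and "Q0 \<in> \<Q>"
    and "differentiable_functional_at k1 \<P> P0"
    and "is_gradient k1 \<P> P0 k1_dot" and "is_canonical_gradient k1 \<P> P0 k1_tilde"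
    and "differentiable_functional_at k2 \<Q> Q0"
    and "is_gradient k2 \<Q> Q0 k2_dot" and "is_canonical_gradient k2 \<Q> Q0 k2_tilde"
    and "open U" and "k1 ` \<P> \<times> k2 ` \<Q> \<subseteq> U"
    and "f differentiable (at (k1 P0, k2 Q0))"
    and "c1 = deriv (\<lambda>x. f (x, k2 Q0)) (k1 P0)"
    and "c2 = deriv (\<lambda>y. f (k1 P0, y)) (k2 Q0)"
    and "\<And>P Q. P \<in> \<P> \<Longrightarrow> Q \<in> \<Q> \<Longrightarrow> k (P \<Otimes>\<^sub>M Q) = f (k1 P, k2 Q)"
  shows "differentiable_functional_at k (product_family \<P> \<Q>) (P0 \<Otimes>\<^sub>M Q0)
    \<and> is_gradient k (product_family \<P> \<Q>) (P0 \<Otimes>\<^sub>M Q0)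
        (\<lambda>(\<omega>1, \<omega>2). c1 * k1_dot \<omega>1 + c2 * k2_dot \<omega>2)
    \<and> is_canonical_gradient k (product_family \<P> \<Q>) (P0 \<Otimes>\<^sub>M Q0)
        (\<lambda>(\<omega>1, \<omega>2). c1 * k1_tilde \<omega>1 + c2 * k2_tilde \<omega>2)"
proof -
  \<comment> \<open>Stated for arbitrary gradients because it serves twice: for the given gradients
    and for the canonical ones, which are gradients too.\<close>
  have c: "is_gradient k (product_family \<P> \<Q>) (P0 \<Otimes>\<^sub>M Q0) (\<lambda>z. c1 * \<kappa>1 (fst z) + c2 * \<kappa>2 (snd z))"
    if "is_gradient k1 \<P> P0 \<kappa>1" "is_gradient k2 \<Q> Q0 \<kappa>2" for \<kappa>1 \<kappa>2
    by (rule is_gradient_product[OF assms(1,3,5,6) that assms(15-18)])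
  note dot = c[OF assms(8,11)]
  have t: "is_gradient k1 \<P> P0 k1_tilde" "k1_tilde \<in> tangent_space P0 \<P>"
    "is_gradient k2 \<Q> Q0 k2_tilde" "k2_tilde \<in> tangent_space Q0 \<Q>"
    using assms(9,12) unfolding is_canonical_gradient_def by blast+
  note tilde = is_canonical_gradientI[OF c[OF t(1,3)] tangent_space_product[OF assms(1,3,5,6) t(2,4)]]
  show ?thesis
    unfolding case_prod_beta' differentiable_functional_at_def using dot tilde by blast
qed

end
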